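(* Let $R$ be a quasi-Frobenius ring, let $M$ be a non-zero finitely generated left $R$-module, and let $M^{*}=\mathrm{Hom}_R(M,R)$ be its $R$-dual, regarded as a right $R$-module. Then: (1) $M$ is an endo-prime left $R$-module if and only if $M^{*}$ is an endo-coprime right $R$-module. (2) $M$ is an endo-coprime left $R$-module if and only if $M^{*}$ is an endo-prime right $R$-module.
   Context: Rings are associative with non-zero identity and modules are unital. For a non-zero (left or right) $R$-module $X$ with endomorphism ring $S=\mathrm{End}_R(X)$, a submodule $K\subseteq X$ is fully invariant if every $f\in S$ maps $K$ into $K$. $X$ is called endo-prime if for every non-zero fully invariant submodule $K$ of $X$ the only $f\in S$ that vanishes on $K$ is $f=0$ (i.e. $\mathrm{Ann}_S(K)=0$). $X$ is called endo-coprime if for every proper fully invariant submodule $K$ of $X$ the only $f\in S$ with $f(X)\subseteq K$ is $f=0$ (i.e. $\mathrm{Ann}_S(X/K)=0$). *)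

theory Defs
  imports "HOL-Algebra.Module"
begin

section \<open>Modules over a not necessarily commutative ring\<close>

text \<open>The library's locale for modules assumes a commutative ring. We keep its records, and its
  notion of submodule, which does not refer to commutativity. For a right module the field
  \<^emph>\<open>smult\<close> is read as the right action: \<open>a \<odot>\<^bsub>X\<^esub> x\<close> stands for \<open>x a\<close>. Left and right modules thus
  differ only in the associativity axiom, and the notions of submodule, homomorphism and
  generation are the same terms for both. The multiplicative fields of a module record play no
  role.\<close>

locale left_module = R?: ring R + M?: abelian_group M for R (structure) and M (structure) +
  assumes smult_closed [simp, intro]:
      "\<lbrakk>a \<in> carrier R; x \<in> carrier M\<rbrakk> \<Longrightarrow> a \<odot>\<^bsub>M\<^esub> x \<in> carrier M"
    and smult_l_distr:
      "\<lbrakk>a \<in> carrier R; b \<in> carrier R; x \<in> carrier M\<rbrakk> \<Longrightarrow>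
        (a \<oplus> b) \<odot>\<^bsub>M\<^esub> x = a \<odot>\<^bsub>M\<^esub> x \<oplus>\<^bsub>M\<^esub> b \<odot>\<^bsub>M\<^esub> x"
    and smult_r_distr:
      "\<lbrakk>a \<in> carrier R; x \<in> carrier M; y \<in> carrier M\<rbrakk> \<Longrightarrow>
        a \<odot>\<^bsub>M\<^esub> (x \<oplus>\<^bsub>M\<^esub> y) = a \<odot>\<^bsub>M\<^esub> x \<oplus>\<^bsub>M\<^esub> a \<odot>\<^bsub>M\<^esub> y"
    and smult_assoc:
      "\<lbrakk>a \<in> carrier R; b \<in> carrier R; x \<in> carrier M\<rbrakk> \<Longrightarrow>
        (a \<otimes> b) \<odot>\<^bsub>M\<^esub> x = a \<odot>\<^bsub>M\<^esub> (b \<odot>\<^bsub>M\<^esub> x)"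
    and smult_one [simp]: "x \<in> carrier M \<Longrightarrow> \<one> \<odot>\<^bsub>M\<^esub> x = x"

locale right_module = R?: ring R + M?: abelian_group M for R (structure) and M (structure) +
  assumes smult_closed [simp, intro]:
      "\<lbrakk>a \<in> carrier R; x \<in> carrier M\<rbrakk> \<Longrightarrow> a \<odot>\<^bsub>M\<^esub> x \<in> carrier M"
    and smult_l_distr:
      "\<lbrakk>a \<in> carrier R; b \<in> carrier R; x \<in> carrier M\<rbrakk> \<Longrightarrow>
        (a \<oplus> b) \<odot>\<^bsub>M\<^esub> x = a \<odot>\<^bsub>M\<^esub> x \<oplus>\<^bsub>M\<^esub> b \<odot>\<^bsub>M\<^esub> x"
    and smult_r_distr:
      "\<lbrakk>a \<in> carrier R; x \<in> carrier M; y \<in> carrier M\<rbrakk> \<Longrightarrow>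
        a \<odot>\<^bsub>M\<^esub> (x \<oplus>\<^bsub>M\<^esub> y) = a \<odot>\<^bsub>M\<^esub> x \<oplus>\<^bsub>M\<^esub> a \<odot>\<^bsub>M\<^esub> y"
    and smult_assoc:
      "\<lbrakk>a \<in> carrier R; b \<in> carrier R; x \<in> carrier M\<rbrakk> \<Longrightarrow>
        (a \<otimes> b) \<odot>\<^bsub>M\<^esub> x = b \<odot>\<^bsub>M\<^esub> (a \<odot>\<^bsub>M\<^esub> x)"
    and smult_one [simp]: "x \<in> carrier M \<Longrightarrow> \<one> \<odot>\<^bsub>M\<^esub> x = x"

definition nonzero_module :: "('a, 'b, 'm) module_scheme \<Rightarrow> bool" where
  "nonzero_module X \<longleftrightarrow> carrier X \<noteq> {\<zero>\<^bsub>X\<^esub>}"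

definition finitely_generated_module ::
    "('a, 'r) ring_scheme \<Rightarrow> ('a, 'b, 'm) module_scheme \<Rightarrow> bool" where
  "finitely_generated_module R X \<longleftrightarrow>
    (\<exists>A. finite A \<and> A \<subseteq> carrier X \<and> \<Inter>{N. submodule N R X \<and> A \<subseteq> N} = carrier X)"

text \<open>Homomorphisms are extensional, so that equality of functions is equality of maps on the
  carrier.\<close>

definition module_homs ::
    "('a, 'r) ring_scheme \<Rightarrow> ('a, 'b, 'm) module_scheme \<Rightarrow> ('a, 'c, 'n) module_scheme
      \<Rightarrow> ('b \<Rightarrow> 'c) set" where
  "module_homs R X Y =
    {f \<in> hom (add_monoid X) (add_monoid Y). f \<in> extensional (carrier X) \<and>
      (\<forall>a\<in>carrier R. \<forall>x\<in>carrier X. f (a \<odot>\<^bsub>X\<^esub> x) = a \<odot>\<^bsub>Y\<^esub> f x)}"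

abbreviation module_endos ::
    "('a, 'r) ring_scheme \<Rightarrow> ('a, 'b, 'm) module_scheme \<Rightarrow> ('b \<Rightarrow> 'b) set" where
  "module_endos R X \<equiv> module_homs R X X"


section \<open>Endo-prime and endo-coprime modules\<close>

definition fully_invariant ::
    "('a, 'r) ring_scheme \<Rightarrow> ('a, 'b, 'm) module_scheme \<Rightarrow> 'b set \<Rightarrow> bool" where
  "fully_invariant R X K \<longleftrightarrow> submodule K R X \<and> (\<forall>f\<in>module_endos R X. f ` K \<subseteq> K)"

definition endo_prime ::
    "('a, 'r) ring_scheme \<Rightarrow> ('a, 'b, 'm) module_scheme \<Rightarrow> bool" where
  "endo_prime R X \<longleftrightarrow> nonzero_module X \<and>
    (\<forall>K. fully_invariant R X K \<and> K \<noteq> {\<zero>\<^bsub>X\<^esub>} \<longrightarrow>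
      (\<forall>f\<in>module_endos R X. (\<forall>x\<in>K. f x = \<zero>\<^bsub>X\<^esub>) \<longrightarrow> f = (\<lambda>x\<in>carrier X. \<zero>\<^bsub>X\<^esub>)))"

definition endo_coprime ::
    "('a, 'r) ring_scheme \<Rightarrow> ('a, 'b, 'm) module_scheme \<Rightarrow> bool" where
  "endo_coprime R X \<longleftrightarrow> nonzero_module X \<and>
    (\<forall>K. fully_invariant R X K \<and> K \<noteq> carrier X \<longrightarrow>
      (\<forall>f\<in>module_endos R X. f ` carrier X \<subseteq> K \<longrightarrow> f = (\<lambda>x\<in>carrier X. \<zero>\<^bsub>X\<^esub>)))"


section \<open>Regular modules and quasi-Frobenius rings\<close>

definition left_regular :: "('a, 'r) ring_scheme \<Rightarrow> ('a, 'a) module" where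
  "left_regular R = \<lparr>carrier = carrier R, mult = mult R, one = one R, zero = zero R, add = add R,
    smult = (\<lambda>a x. a \<otimes>\<^bsub>R\<^esub> x)\<rparr>"

definition right_regular :: "('a, 'r) ring_scheme \<Rightarrow> ('a, 'a) module" where
  "right_regular R = \<lparr>carrier = carrier R, mult = mult R, one = one R, zero = zero R, add = add R,
    smult = (\<lambda>a x. x \<otimes>\<^bsub>R\<^esub> a)\<rparr>"

abbreviation left_ideal :: "'a set \<Rightarrow> ('a, 'r) ring_scheme \<Rightarrow> bool" where
  "left_ideal I R \<equiv> submodule I R (left_regular R)"

abbreviation right_ideal :: "'a set \<Rightarrow> ('a, 'r) ring_scheme \<Rightarrow> bool" where
  "right_ideal I R \<equiv> submodule I R (right_regular R)"

definition artinian_module ::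
    "('a, 'r) ring_scheme \<Rightarrow> ('a, 'b, 'm) module_scheme \<Rightarrow> bool" where
  "artinian_module R X \<longleftrightarrow>
    (\<forall>N :: nat \<Rightarrow> 'b set. (\<forall>i. submodule (N i) R X) \<and> antimono N \<longrightarrow> (\<exists>n. \<forall>m\<ge>n. N m = N n))"

definition left_annihilator :: "('a, 'r) ring_scheme \<Rightarrow> 'a set \<Rightarrow> 'a set" where
  "left_annihilator R A = {r \<in> carrier R. \<forall>x\<in>A. r \<otimes>\<^bsub>R\<^esub> x = \<zero>\<^bsub>R\<^esub>}"

definition right_annihilator :: "('a, 'r) ring_scheme \<Rightarrow> 'a set \<Rightarrow> 'a set" where
  "right_annihilator R A = {r \<in> carrier R. \<forall>x\<in>A. x \<otimes>\<^bsub>R\<^esub> r = \<zero>\<^bsub>R\<^esub>}"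

text \<open>Nakayama's definition: a two-sided Artinian ring in which every one-sided ideal is an
  annihilator (Lam, Lectures on Modules and Rings, Section 15). Unlike the definition by
  self-injectivity it does not quantify over a class of modules.\<close>

definition quasi_Frobenius_ring :: "('a, 'r) ring_scheme \<Rightarrow> bool" where
  "quasi_Frobenius_ring R \<longleftrightarrow> ring R \<and> \<one>\<^bsub>R\<^esub> \<noteq> \<zero>\<^bsub>R\<^esub> \<and>
    artinian_module R (left_regular R) \<and> artinian_module R (right_regular R) \<and>
    (\<forall>I. left_ideal I R \<longrightarrow> left_annihilator R (right_annihilator R I) = I) \<and>
    (\<forall>I. right_ideal I R \<longrightarrow> right_annihilator R (left_annihilator R I) = I)"


section \<open>The dual of a left module\<close>

text \<open>The right action is \<open>(f a) x = (f x) a\<close>.\<close>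

definition dual_module ::
    "('a, 'r) ring_scheme \<Rightarrow> ('a, 'b, 'm) module_scheme \<Rightarrow> ('a, 'b \<Rightarrow> 'a) module" where
  "dual_module R M = \<lparr>carrier = module_homs R M (left_regular R),
    mult = undefined, one = undefined,
    zero = (\<lambda>x\<in>carrier M. \<zero>\<^bsub>R\<^esub>),
    add = (\<lambda>f g. \<lambda>x\<in>carrier M. f x \<oplus>\<^bsub>R\<^esub> g x),
    smult = (\<lambda>a f. \<lambda>x\<in>carrier M. f x \<otimes>\<^bsub>R\<^esub> a)\<rparr>"

lemma left_module_left_regular: "ring R \<Longrightarrow> left_module R (left_regular R)"
proof -
  assume "ring R"
  then interpret ring R .
  show ?thesis
    by unfold_locales
      (auto simp: left_regular_def l_distr r_distr m_assoc a_ac Units_def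
        intro: l_neg r_neg a_inv_closed)
qed

lemma right_module_right_regular: "ring R \<Longrightarrow> right_module R (right_regular R)"
proof -
  assume "ring R"
  then interpret ring R .
  show ?thesis
    by unfold_locales
      (auto simp: right_regular_def l_distr r_distr m_assoc a_ac Units_def
        intro: l_neg r_neg a_inv_closed)
qed

lemma (in left_module) mem_dual_iff:
  "f \<in> carrier (dual_module R M) \<longleftrightarrow>
    f \<in> extensional (carrier M) \<and> (\<forall>x\<in>carrier M. f x \<in> carrier R) \<and>
    (\<forall>x\<in>carrier M. \<forall>y\<in>carrier M. f (x \<oplus>\<^bsub>M\<^esub> y) = f x \<oplus> f y) \<and>
    (\<forall>a\<in>carrier R. \<forall>x\<in>carrier M. f (a \<odot>\<^bsub>M\<^esub> x) = a \<otimes> f x)"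
  by (auto simp: dual_module_def module_homs_def left_regular_def hom_def)

lemma (in left_module) right_module_dual: "right_module R (dual_module R M)"
proof -
  let ?D = "dual_module R M"
  have add_eq: "f \<oplus>\<^bsub>?D\<^esub> g = (\<lambda>x\<in>carrier M. f x \<oplus> g x)" for f g
    by (simp add: dual_module_def)
  have smult_eq: "a \<odot>\<^bsub>?D\<^esub> f = (\<lambda>x\<in>carrier M. f x \<otimes> a)" for a f
    by (simp add: dual_module_def)
  have zero_eq: "\<zero>\<^bsub>?D\<^esub> = (\<lambda>x\<in>carrier M. \<zero>)"
    by (simp add: dual_module_def)
  have memD: "f \<in> extensional (carrier M)" "\<And>x. x \<in> carrier M \<Longrightarrow> f x \<in> carrier R"
    if "f \<in> carrier ?D" for f
    using that by (auto simp: mem_dual_iff)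
  have "abelian_group ?D"
  proof (rule abelian_groupI)
    fix f g assume fg: "f \<in> carrier ?D" "g \<in> carrier ?D"
    then show "f \<oplus>\<^bsub>?D\<^esub> g \<in> carrier ?D"
      unfolding mem_dual_iff add_eq by (auto simp: R.a_ac R.r_distr)
    show "f \<oplus>\<^bsub>?D\<^esub> g = g \<oplus>\<^bsub>?D\<^esub> f"
      unfolding add_eq using memD[OF fg(1)] memD[OF fg(2)] by (auto simp: R.a_comm)
  next
    show "\<zero>\<^bsub>?D\<^esub> \<in> carrier ?D"
      unfolding mem_dual_iff zero_eq by auto
  next
    fix f g h assume "f \<in> carrier ?D" "g \<in> carrier ?D" "h \<in> carrier ?D"
    then show "f \<oplus>\<^bsub>?D\<^esub> g \<oplus>\<^bsub>?D\<^esub> h = f \<oplus>\<^bsub>?D\<^esub> (g \<oplus>\<^bsub>?D\<^esub> h)"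
      unfolding add_eq by (auto simp: fun_eq_iff R.a_assoc memD(2))
  next
    fix f assume f: "f \<in> carrier ?D"
    then show "\<zero>\<^bsub>?D\<^esub> \<oplus>\<^bsub>?D\<^esub> f = f"
      unfolding add_eq zero_eq using memD[OF f] by (auto simp: fun_eq_iff extensional_def)
    let ?g = "\<lambda>x\<in>carrier M. \<ominus> f x"
    have "?g \<in> carrier ?D"
      using f unfolding mem_dual_iff by (auto simp: R.minus_add R.r_minus R.a_comm)
    moreover have "?g \<oplus>\<^bsub>?D\<^esub> f = \<zero>\<^bsub>?D\<^esub>"
      unfolding add_eq zero_eq using memD[OF f] by (auto simp: fun_eq_iff R.l_neg)
    ultimately show "\<exists>g\<in>carrier ?D. g \<oplus>\<^bsub>?D\<^esub> f = \<zero>\<^bsub>?D\<^esub>" by blast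
  qed
  moreover have "right_module_axioms R ?D"
  proof
    fix a f assume "a \<in> carrier R" "f \<in> carrier ?D"
    then show "a \<odot>\<^bsub>?D\<^esub> f \<in> carrier ?D"
      unfolding mem_dual_iff smult_eq by (auto simp: R.l_distr R.m_assoc)
  next
    fix a b f assume "a \<in> carrier R" "b \<in> carrier R" "f \<in> carrier ?D"
    then show "(a \<oplus> b) \<odot>\<^bsub>?D\<^esub> f = a \<odot>\<^bsub>?D\<^esub> f \<oplus>\<^bsub>?D\<^esub> b \<odot>\<^bsub>?D\<^esub> f"
      and "(a \<otimes> b) \<odot>\<^bsub>?D\<^esub> f = b \<odot>\<^bsub>?D\<^esub> (a \<odot>\<^bsub>?D\<^esub> f)"
      unfolding smult_eq add_eq by (auto simp: fun_eq_iff R.r_distr R.m_assoc memD(2))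
  next
    fix a f g assume "a \<in> carrier R" "f \<in> carrier ?D" "g \<in> carrier ?D"
    then show "a \<odot>\<^bsub>?D\<^esub> (f \<oplus>\<^bsub>?D\<^esub> g) = a \<odot>\<^bsub>?D\<^esub> f \<oplus>\<^bsub>?D\<^esub> a \<odot>\<^bsub>?D\<^esub> g"
      unfolding smult_eq add_eq by (auto simp: fun_eq_iff R.l_distr memD(2))
  next
    fix f assume f: "f \<in> carrier ?D"
    show "\<one> \<odot>\<^bsub>?D\<^esub> f = f"
      unfolding smult_eq using memD[OF f] by (auto simp: fun_eq_iff extensional_def)
  qed
  ultimately show ?thesis
    by (intro right_module.intro R.ring_axioms)
qed

end

theory Submission
  imports Defs "HOL-Algebra.AbelCoset"
begin

text \<open>The duality between \<open>M\<close> and \<open>M\<^sup>*\<close> exchanges the two notions. For a submodule \<open>K\<close> of \<open>M\<close> let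
  \<open>K\<^sup>\<bottom>\<close> be the set of the functionals in \<open>M\<^sup>*\<close> that vanish on \<open>K\<close>, and for an endomorphism \<open>f\<close> of \<open>M\<close>
  let \<open>f\<^sup>*\<close> be its transpose \<open>g \<mapsto> g \<circ> f\<close>. Over a quasi-Frobenius ring with \<open>M\<close> finitely generated,
  \<open>K \<mapsto> K\<^sup>\<bottom>\<close> is an inclusion-reversing bijection from the submodules of \<open>M\<close> to those of \<open>M\<^sup>*\<close>, and
  \<open>f \<mapsto> f\<^sup>*\<close> is a bijection from the endomorphisms of \<open>M\<close> to those of \<open>M\<^sup>*\<close>. Therefore \<open>K\<close> is fully
  invariant exactly if \<open>K\<^sup>\<bottom>\<close> is. Moreover \<open>f\<close> vanishes on \<open>K\<close> if and only if the image of \<open>f\<^sup>*\<close> lies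
  in \<open>K\<^sup>\<bottom>\<close>, and the image of \<open>f\<close> lies in \<open>K\<close> if and only if \<open>f\<^sup>*\<close> vanishes on \<open>K\<^sup>\<bottom>\<close>. As \<open>0\<^sup>\<bottom> = M\<^sup>*\<close> and
  \<open>M\<^sup>\<bottom> = 0\<close>, the condition that makes \<open>M\<close> endo-prime is, term by term, the one that makes \<open>M\<^sup>*\<close>
  endo-coprime, and conversely.

  Nakayama's definition has to be turned into these duality statements. Its core consequence is a
  form of self-injectivity, \<open>functional_on_left_ideal\<close>: every linear map from a one-sided ideal to
  \<open>R\<close> is a multiplication. It follows from the double annihilator conditions, which make it possible
  to enlarge by one element an ideal on which the map is a multiplication, and from the descending
  chain condition for the annihilators of such ideals.

  Two consequences carry the duality. A functional on a submodule of \<open>M\<close> extends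
  to \<open>M\<close> by adjoining the generators one at a time; as a proper left ideal is killed by some
  non-zero \<open>c\<close>, a functional can moreover be chosen to separate a given point from a submodule
  (\<open>dual_separates\<close>), and this gives \<open>K\<^sup>\<bottom>\<^sup>\<bottom> = K\<close>. Secondly, every functional on a submodule of \<open>M\<^sup>*\<close> is
  evaluation at a point of \<open>M\<close> (\<open>functional_on_dual_is_evaluation\<close>), by induction over the generators
  of \<open>M\<close>. Applied to \<open>M\<^sup>*\<close> this shows that every endomorphism of \<open>M\<^sup>*\<close> is a transpose; applied to a
  functional that separates \<open>h\<close> from a submodule \<open>L\<close>, it shows \<open>L\<^sup>\<bottom>\<^sup>\<bottom> = L\<close>.\<close>

section \<open>Functionals on submodules\<close>

text \<open>A functional is a function on the whole type whose values outside \<open>N\<close> are arbitrary. So an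
  extension to a larger submodule is a functional that agrees on \<open>N\<close>, and restriction to a smaller
  submodule leaves the function as it is. Over the opposite ring these are the right linear
  functionals.\<close>

definition functional_on ::
    "('a, 'r) ring_scheme \<Rightarrow> ('a, 'b, 'm) module_scheme \<Rightarrow> 'b set \<Rightarrow> ('b \<Rightarrow> 'a) \<Rightarrow> bool" where
  "functional_on R X N \<phi> \<longleftrightarrow> (\<forall>x\<in>N. \<phi> x \<in> carrier R) \<and>
    (\<forall>x\<in>N. \<forall>y\<in>N. \<phi> (x \<oplus>\<^bsub>X\<^esub> y) = \<phi> x \<oplus>\<^bsub>R\<^esub> \<phi> y) \<and>
    (\<forall>a\<in>carrier R. \<forall>x\<in>N. \<phi> (a \<odot>\<^bsub>X\<^esub> x) = a \<otimes>\<^bsub>R\<^esub> \<phi> x)"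

lemma functional_onD:
  assumes "functional_on R X N \<phi>"
  shows "x \<in> N \<Longrightarrow> \<phi> x \<in> carrier R"
    and "\<lbrakk>x \<in> N; y \<in> N\<rbrakk> \<Longrightarrow> \<phi> (x \<oplus>\<^bsub>X\<^esub> y) = \<phi> x \<oplus>\<^bsub>R\<^esub> \<phi> y"
    and "\<lbrakk>a \<in> carrier R; x \<in> N\<rbrakk> \<Longrightarrow> \<phi> (a \<odot>\<^bsub>X\<^esub> x) = a \<otimes>\<^bsub>R\<^esub> \<phi> x"
  using assms by (auto simp: functional_on_def)

lemma (in ring) add_minus_cancel:
  assumes "x \<in> carrier R" "y \<in> carrier R"
  shows "x \<oplus> (y \<ominus> x) = y"
proof -
  have "x \<oplus> (y \<ominus> x) = y \<oplus> (x \<oplus> \<ominus> x)"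
    using assms by (simp only: minus_eq a_lcomm a_inv_closed)
  then show ?thesis using assms by (simp add: r_neg)
qed

context left_module
begin

lemma smult_l_null [simp]:
  assumes "x \<in> carrier M" shows "\<zero> \<odot>\<^bsub>M\<^esub> x = \<zero>\<^bsub>M\<^esub>"
proof -
  have "\<zero> \<odot>\<^bsub>M\<^esub> x \<oplus>\<^bsub>M\<^esub> \<zero> \<odot>\<^bsub>M\<^esub> x = \<zero> \<odot>\<^bsub>M\<^esub> x"
    using smult_l_distr[of \<zero> \<zero> x] assms by simp
  then show ?thesis using assms by (simp add: M.add.r_cancel_one')
qed

lemma smult_r_null [simp]:
  assumes "a \<in> carrier R" shows "a \<odot>\<^bsub>M\<^esub> \<zero>\<^bsub>M\<^esub> = \<zero>\<^bsub>M\<^esub>"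
proof -
  have "a \<odot>\<^bsub>M\<^esub> \<zero>\<^bsub>M\<^esub> \<oplus>\<^bsub>M\<^esub> a \<odot>\<^bsub>M\<^esub> \<zero>\<^bsub>M\<^esub> = a \<odot>\<^bsub>M\<^esub> \<zero>\<^bsub>M\<^esub>"
    using smult_r_distr[of a "\<zero>\<^bsub>M\<^esub>" "\<zero>\<^bsub>M\<^esub>"] assms by simp
  then show ?thesis using assms by (simp add: M.add.r_cancel_one')
qed

lemma smult_l_minus:
  assumes "a \<in> carrier R" "x \<in> carrier M"
  shows "(\<ominus> a) \<odot>\<^bsub>M\<^esub> x = \<ominus>\<^bsub>M\<^esub> (a \<odot>\<^bsub>M\<^esub> x)"
proof -
  have "(\<ominus> a) \<odot>\<^bsub>M\<^esub> x \<oplus>\<^bsub>M\<^esub> a \<odot>\<^bsub>M\<^esub> x = \<zero>\<^bsub>M\<^esub>"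
    using smult_l_distr[of "\<ominus> a" a x] assms by (simp add: R.l_neg)
  then show ?thesis using assms by (metis M.minus_equality R.a_inv_closed smult_closed)
qed

lemma submodule_iff:
  "submodule N R M \<longleftrightarrow> N \<subseteq> carrier M \<and> \<zero>\<^bsub>M\<^esub> \<in> N \<and> (\<forall>x\<in>N. \<forall>y\<in>N. x \<oplus>\<^bsub>M\<^esub> y \<in> N) \<and>
    (\<forall>a\<in>carrier R. \<forall>x\<in>N. a \<odot>\<^bsub>M\<^esub> x \<in> N)"
proof
  assume "submodule N R M"
  then interpret submodule N R M .
  show "N \<subseteq> carrier M \<and> \<zero>\<^bsub>M\<^esub> \<in> N \<and> (\<forall>x\<in>N. \<forall>y\<in>N. x \<oplus>\<^bsub>M\<^esub> y \<in> N) \<and>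
    (\<forall>a\<in>carrier R. \<forall>x\<in>N. a \<odot>\<^bsub>M\<^esub> x \<in> N)"
    using subset one_closed m_closed smult_closed by auto
next
  assume N: "N \<subseteq> carrier M \<and> \<zero>\<^bsub>M\<^esub> \<in> N \<and> (\<forall>x\<in>N. \<forall>y\<in>N. x \<oplus>\<^bsub>M\<^esub> y \<in> N) \<and>
    (\<forall>a\<in>carrier R. \<forall>x\<in>N. a \<odot>\<^bsub>M\<^esub> x \<in> N)"
  have "\<ominus>\<^bsub>M\<^esub> x \<in> N" if "x \<in> N" for x
    using N that smult_l_minus[of \<one> x] by (metis R.a_inv_closed R.one_closed smult_one subsetD)
  then show "submodule N R M"
    using N by unfold_locales (auto simp: a_inv_def)
qed

lemma submoduleD:
  assumes "submodule N R M"
  shows "x \<in> N \<Longrightarrow> x \<in> carrier M" and "\<zero>\<^bsub>M\<^esub> \<in> N"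
    and "\<lbrakk>x \<in> N; y \<in> N\<rbrakk> \<Longrightarrow> x \<oplus>\<^bsub>M\<^esub> y \<in> N"
    and "\<lbrakk>a \<in> carrier R; x \<in> N\<rbrakk> \<Longrightarrow> a \<odot>\<^bsub>M\<^esub> x \<in> N"
  using assms by (auto simp: submodule_iff)

lemma submodule_minus:
  assumes N: "submodule N R M" and x: "x \<in> N"
  shows "\<ominus>\<^bsub>M\<^esub> x \<in> N"
  using submoduleD(4)[OF N _ x, of "\<ominus> \<one>"] smult_l_minus[of \<one> x] submoduleD(1)[OF N x] by simp

lemma submodule_cyclic:
  assumes x: "x \<in> carrier M"
  shows "submodule {a \<odot>\<^bsub>M\<^esub> x | a. a \<in> carrier R} R M"
  unfolding submodule_iff using x
  by (auto simp: smult_l_distr[symmetric] smult_assoc[symmetric] intro: smult_l_null[symmetric])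

lemma submodule_set_add:
  assumes N: "submodule N R M" and K: "submodule K R M"
  shows "submodule (N <+>\<^bsub>M\<^esub> K) R M"
  unfolding submodule_iff
proof (intro conjI ballI)
  note [simp] = submoduleD[OF N] submoduleD[OF K]
  show "N <+>\<^bsub>M\<^esub> K \<subseteq> carrier M"
    by (auto simp: set_add_def')
  show "\<zero>\<^bsub>M\<^esub> \<in> N <+>\<^bsub>M\<^esub> K"
    using submoduleD(2)[OF N] submoduleD(2)[OF K] M.l_zero[OF M.zero_closed]
    unfolding set_add_def' by fastforce
next
  note [simp] = submoduleD[OF N] submoduleD[OF K]
  fix x y assume "x \<in> N <+>\<^bsub>M\<^esub> K" "y \<in> N <+>\<^bsub>M\<^esub> K"
  then obtain n k n' k' where nk: "n \<in> N" "k \<in> K" "n' \<in> N" "k' \<in> K"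
    and xy: "x = n \<oplus>\<^bsub>M\<^esub> k" "y = n' \<oplus>\<^bsub>M\<^esub> k'"
    by (auto simp: set_add_def')
  have "x \<oplus>\<^bsub>M\<^esub> y = (n \<oplus>\<^bsub>M\<^esub> n') \<oplus>\<^bsub>M\<^esub> (k \<oplus>\<^bsub>M\<^esub> k')"
    unfolding xy using nk by (simp add: M.a_ac)
  moreover have "n \<oplus>\<^bsub>M\<^esub> n' \<in> N" "k \<oplus>\<^bsub>M\<^esub> k' \<in> K" using nk by simp_all
  ultimately show "x \<oplus>\<^bsub>M\<^esub> y \<in> N <+>\<^bsub>M\<^esub> K" unfolding set_add_def' by blast
next
  note [simp] = submoduleD[OF N] submoduleD[OF K]
  fix a x assume a: "a \<in> carrier R" and "x \<in> N <+>\<^bsub>M\<^esub> K"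
  then obtain n k where nk: "n \<in> N" "k \<in> K" and x: "x = n \<oplus>\<^bsub>M\<^esub> k"
    by (auto simp: set_add_def')
  have "a \<odot>\<^bsub>M\<^esub> x = a \<odot>\<^bsub>M\<^esub> n \<oplus>\<^bsub>M\<^esub> a \<odot>\<^bsub>M\<^esub> k"
    unfolding x using nk a by (simp add: smult_r_distr)
  moreover have "a \<odot>\<^bsub>M\<^esub> n \<in> N" "a \<odot>\<^bsub>M\<^esub> k \<in> K" using nk a by simp_all
  ultimately show "a \<odot>\<^bsub>M\<^esub> x \<in> N <+>\<^bsub>M\<^esub> K" unfolding set_add_def' by blast
qed

lemma subset_set_add:
  assumes N: "submodule N R M" and K: "submodule K R M"
  shows "N \<subseteq> N <+>\<^bsub>M\<^esub> K" and "K \<subseteq> N <+>\<^bsub>M\<^esub> K"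
proof -
  have "n = n \<oplus>\<^bsub>M\<^esub> \<zero>\<^bsub>M\<^esub>" if "n \<in> N" for n using submoduleD(1)[OF N that] by simp
  then show "N \<subseteq> N <+>\<^bsub>M\<^esub> K" using submoduleD(2)[OF K] unfolding set_add_def' by blast
  have "k = \<zero>\<^bsub>M\<^esub> \<oplus>\<^bsub>M\<^esub> k" if "k \<in> K" for k using submoduleD(1)[OF K that] by simp
  then show "K \<subseteq> N <+>\<^bsub>M\<^esub> K" using submoduleD(2)[OF N] unfolding set_add_def' by blast
qed

lemma functional_zero:
  assumes "submodule N R M" "functional_on R M N \<phi>"
  shows "\<phi> \<zero>\<^bsub>M\<^esub> = \<zero>"
  using functional_onD(3)[OF assms(2), of \<zero> "\<zero>\<^bsub>M\<^esub>"] functional_onD(1)[OF assms(2)]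
    submoduleD[OF assms(1)] by simp

lemma functional_minus:
  assumes N: "submodule N R M" and f: "functional_on R M N \<phi>" and x: "x \<in> N"
  shows "\<phi> (\<ominus>\<^bsub>M\<^esub> x) = \<ominus> \<phi> x"
  using functional_onD(3)[OF f _ x, of "\<ominus> \<one>"] functional_onD(1)[OF f x] smult_l_minus[of \<one> x]
    submoduleD(1)[OF N x] by (simp add: R.l_minus)

text \<open>The value \<open>c\<close> at the new generator may be any that agrees with the values fixed already at the
  multiples of \<open>m\<close> in \<open>N\<close>. The formula \<open>n + r m \<mapsto> \<phi> n + r c\<close> is then well defined, because two
  representations of the same element differ by a multiple of \<open>m\<close> that lies in \<open>N\<close>. Both the extension of functionals and the
  separation of a point from a submodule are instances.\<close>

lemma functional_adjoin:
  assumes N: "submodule N R M" and f: "functional_on R M N \<phi>"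
    and m: "m \<in> carrier M" and c: "c \<in> carrier R"
    and compat: "\<And>r. \<lbrakk>r \<in> carrier R; r \<odot>\<^bsub>M\<^esub> m \<in> N\<rbrakk> \<Longrightarrow> \<phi> (r \<odot>\<^bsub>M\<^esub> m) = r \<otimes> c"
  obtains N' \<phi>' where "submodule N' R M" "N \<subseteq> N'" "m \<in> N'" "functional_on R M N' \<phi>'"
    "\<And>x. x \<in> N \<Longrightarrow> \<phi>' x = \<phi> x" "\<phi>' m = c"
proof -
  note [simp] = submoduleD[OF N] functional_onD[OF f] m c
  let ?C = "{r \<odot>\<^bsub>M\<^esub> m | r. r \<in> carrier R}"
  have C: "submodule ?C R M" by (rule submodule_cyclic) simp
  define N' where "N' = N <+>\<^bsub>M\<^esub> ?C"
  have N'_iff: "y \<in> N' \<longleftrightarrow> (\<exists>n\<in>N. \<exists>r\<in>carrier R. y = n \<oplus>\<^bsub>M\<^esub> r \<odot>\<^bsub>M\<^esub> m)" for y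
    unfolding N'_def set_add_def' by blast
  define \<phi>' where "\<phi>' y = (SOME z. \<exists>n\<in>N. \<exists>r\<in>carrier R.
      y = n \<oplus>\<^bsub>M\<^esub> r \<odot>\<^bsub>M\<^esub> m \<and> z = \<phi> n \<oplus> r \<otimes> c)" for y
  have wd: "\<phi> n \<oplus> r \<otimes> c = \<phi> n' \<oplus> r' \<otimes> c"
    if n: "n \<in> N" "n' \<in> N" and r: "r \<in> carrier R" "r' \<in> carrier R"
      and eq: "n \<oplus>\<^bsub>M\<^esub> r \<odot>\<^bsub>M\<^esub> m = n' \<oplus>\<^bsub>M\<^esub> r' \<odot>\<^bsub>M\<^esub> m" for n n' r r'
  proof -
    let ?s = "r \<oplus> \<ominus> r'"
    have n': "n' = n \<oplus>\<^bsub>M\<^esub> ?s \<odot>\<^bsub>M\<^esub> m"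
    proof -
      have "n \<oplus>\<^bsub>M\<^esub> ?s \<odot>\<^bsub>M\<^esub> m = (n \<oplus>\<^bsub>M\<^esub> r \<odot>\<^bsub>M\<^esub> m) \<oplus>\<^bsub>M\<^esub> \<ominus>\<^bsub>M\<^esub> (r' \<odot>\<^bsub>M\<^esub> m)"
        using n r by (simp add: smult_l_distr smult_l_minus M.a_assoc)
      also have "\<dots> = n'"
        unfolding eq using n r by (simp add: M.a_assoc M.r_neg)
      finally show ?thesis ..
    qed
    have "?s \<odot>\<^bsub>M\<^esub> m = \<ominus>\<^bsub>M\<^esub> n \<oplus>\<^bsub>M\<^esub> n'"
      unfolding n' using n r by (simp add: M.a_assoc[symmetric] M.l_neg)
    then have sN: "?s \<odot>\<^bsub>M\<^esub> m \<in> N"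
      using n submodule_minus[OF N] by simp
    have "\<phi> n' \<oplus> r' \<otimes> c = \<phi> n \<oplus> ?s \<otimes> c \<oplus> r' \<otimes> c"
      unfolding n' using n r sN compat[of ?s] by simp
    also have "\<dots> = \<phi> n \<oplus> r \<otimes> c"
      using n r by (simp add: R.a_assoc R.l_distr[symmetric] R.l_neg)
    finally show ?thesis ..
  qed
  have val: "\<phi>' (n \<oplus>\<^bsub>M\<^esub> r \<odot>\<^bsub>M\<^esub> m) = \<phi> n \<oplus> r \<otimes> c" if "n \<in> N" "r \<in> carrier R" for n r
    unfolding \<phi>'_def
  proof (rule some_equality)
    show "\<exists>n'\<in>N. \<exists>r'\<in>carrier R. n \<oplus>\<^bsub>M\<^esub> r \<odot>\<^bsub>M\<^esub> m = n' \<oplus>\<^bsub>M\<^esub> r' \<odot>\<^bsub>M\<^esub> m \<and>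
        \<phi> n \<oplus> r \<otimes> c = \<phi> n' \<oplus> r' \<otimes> c"
      using that by blast
  next
    fix z assume "\<exists>n'\<in>N. \<exists>r'\<in>carrier R. n \<oplus>\<^bsub>M\<^esub> r \<odot>\<^bsub>M\<^esub> m = n' \<oplus>\<^bsub>M\<^esub> r' \<odot>\<^bsub>M\<^esub> m \<and>
        z = \<phi> n' \<oplus> r' \<otimes> c"
    then obtain n' r' where "n' \<in> N" "r' \<in> carrier R" and z: "z = \<phi> n' \<oplus> r' \<otimes> c"
      and "n \<oplus>\<^bsub>M\<^esub> r \<odot>\<^bsub>M\<^esub> m = n' \<oplus>\<^bsub>M\<^esub> r' \<odot>\<^bsub>M\<^esub> m" by blast
    then show "z = \<phi> n \<oplus> r \<otimes> c"
      unfolding z using that by (intro wd) simp_all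
  qed
  have sum: "(n \<oplus>\<^bsub>M\<^esub> r \<odot>\<^bsub>M\<^esub> m) \<oplus>\<^bsub>M\<^esub> (n' \<oplus>\<^bsub>M\<^esub> r' \<odot>\<^bsub>M\<^esub> m) = (n \<oplus>\<^bsub>M\<^esub> n') \<oplus>\<^bsub>M\<^esub> (r \<oplus> r') \<odot>\<^bsub>M\<^esub> m"
    if "n \<in> N" "n' \<in> N" "r \<in> carrier R" "r' \<in> carrier R" for n n' r r'
    using that by (simp add: smult_l_distr M.a_ac)
  have scale: "a \<odot>\<^bsub>M\<^esub> (n \<oplus>\<^bsub>M\<^esub> r \<odot>\<^bsub>M\<^esub> m) = a \<odot>\<^bsub>M\<^esub> n \<oplus>\<^bsub>M\<^esub> (a \<otimes> r) \<odot>\<^bsub>M\<^esub> m"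
    if "n \<in> N" "r \<in> carrier R" "a \<in> carrier R" for n r a
    using that by (simp add: smult_r_distr smult_assoc)
  have gen: "m = \<zero>\<^bsub>M\<^esub> \<oplus>\<^bsub>M\<^esub> \<one> \<odot>\<^bsub>M\<^esub> m"
    by simp
  show ?thesis
  proof (rule that)
    show "submodule N' R M" "N \<subseteq> N'"
      unfolding N'_def by (fact submodule_set_add[OF N C] subset_set_add(1)[OF N C])+
    show "m \<in> N'"
      unfolding N'_iff by (intro bexI[of _ "\<zero>\<^bsub>M\<^esub>"] bexI[of _ \<one>]) (rule gen, simp_all)
    show "functional_on R M N' \<phi>'"
      unfolding functional_on_def
    proof (intro conjI ballI)
      fix x assume "x \<in> N'"
      then show "\<phi>' x \<in> carrier R" by (auto simp: N'_iff val)
    next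
      fix x y assume "x \<in> N'" "y \<in> N'"
      then obtain n r n' r' where nr: "n \<in> N" "r \<in> carrier R" "x = n \<oplus>\<^bsub>M\<^esub> r \<odot>\<^bsub>M\<^esub> m"
        "n' \<in> N" "r' \<in> carrier R" "y = n' \<oplus>\<^bsub>M\<^esub> r' \<odot>\<^bsub>M\<^esub> m"
        unfolding N'_iff by blast
      then have "\<phi>' (x \<oplus>\<^bsub>M\<^esub> y) = \<phi> (n \<oplus>\<^bsub>M\<^esub> n') \<oplus> (r \<oplus> r') \<otimes> c"
        by (simp only: sum val submoduleD(3)[OF N] R.a_closed)
      also have "\<dots> = (\<phi> n \<oplus> r \<otimes> c) \<oplus> (\<phi> n' \<oplus> r' \<otimes> c)"
        using nr by (simp add: R.l_distr R.a_ac)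
      finally show "\<phi>' (x \<oplus>\<^bsub>M\<^esub> y) = \<phi>' x \<oplus> \<phi>' y"
        using nr by (simp only: val)
    next
      fix a x assume a: "a \<in> carrier R" and "x \<in> N'"
      then obtain n r where nr: "n \<in> N" "r \<in> carrier R" "x = n \<oplus>\<^bsub>M\<^esub> r \<odot>\<^bsub>M\<^esub> m"
        unfolding N'_iff by blast
      then have "\<phi>' (a \<odot>\<^bsub>M\<^esub> x) = \<phi> (a \<odot>\<^bsub>M\<^esub> n) \<oplus> (a \<otimes> r) \<otimes> c"
        using a by (simp only: scale val submoduleD(4)[OF N] R.m_closed)
      also have "\<dots> = a \<otimes> (\<phi> n \<oplus> r \<otimes> c)"
        using nr a by (simp add: R.r_distr R.m_assoc)
      finally show "\<phi>' (a \<odot>\<^bsub>M\<^esub> x) = a \<otimes> \<phi>' x"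
        using nr by (simp only: val)
    qed
    show "\<phi>' x = \<phi> x" if "x \<in> N" for x
      using val[OF that R.zero_closed] that by simp
    show "\<phi>' m = c"
      using val[of "\<zero>\<^bsub>M\<^esub>" \<one>] gen functional_zero[OF N f] by simp
  qed
qed

end

section \<open>One-sided ideals and the opposite ring\<close>

lemma (in ring) left_ideal_iff:
  "left_ideal I R \<longleftrightarrow> I \<subseteq> carrier R \<and> \<zero> \<in> I \<and> (\<forall>x\<in>I. \<forall>y\<in>I. x \<oplus> y \<in> I) \<and>
    (\<forall>a\<in>carrier R. \<forall>x\<in>I. a \<otimes> x \<in> I)"
  using left_module.submodule_iff[OF left_module_left_regular[OF ring_axioms], of I]
  by (simp add: left_regular_def)

text \<open>Right modules over \<open>R\<close> are left modules over the opposite ring, and being quasi-Frobenius is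
  symmetric. Each fact needed on both sides is therefore proved for left modules and transported.\<close>

definition opposite_ring :: "('a, 'r) ring_scheme \<Rightarrow> ('a, 'r) ring_scheme" where
  "opposite_ring R = R\<lparr>mult := (\<lambda>x y. y \<otimes>\<^bsub>R\<^esub> x)\<rparr>"

lemma opposite_ring_simps [simp]:
  "carrier (opposite_ring R) = carrier R" "\<zero>\<^bsub>opposite_ring R\<^esub> = \<zero>\<^bsub>R\<^esub>"
  "\<one>\<^bsub>opposite_ring R\<^esub> = \<one>\<^bsub>R\<^esub>" "x \<oplus>\<^bsub>opposite_ring R\<^esub> y = x \<oplus>\<^bsub>R\<^esub> y"
  "x \<otimes>\<^bsub>opposite_ring R\<^esub> y = y \<otimes>\<^bsub>R\<^esub> x" "add (opposite_ring R) = add R"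
  by (simp_all add: opposite_ring_def)

lemma a_inv_opposite [simp]: "\<ominus>\<^bsub>opposite_ring R\<^esub> x = \<ominus>\<^bsub>R\<^esub> x"
  by (simp add: a_inv_def m_inv_def)

lemma (in ring) ring_opposite: "ring (opposite_ring R)"
proof (rule ringI)
  show "abelian_group (opposite_ring R)"
    by (rule abelian_groupI) (auto simp: a_ac intro!: l_neg bexI[of _ "\<ominus> _"])
  show "monoid (opposite_ring R)"
    by (rule monoidI) (simp_all add: m_assoc)
qed (simp_all add: l_distr r_distr)

text \<open>The regular modules of the opposite ring differ from those of \<open>R\<close> in their multiplicative fields,
  so they are not equal as records; submodules do not see the difference.\<close>

lemma submodule_cong:
  assumes "carrier R = carrier R'" "carrier X = carrier X'" "add X = add X'" "zero X = zero X'"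
    "smult X = smult X'"
  shows "submodule N R X \<longleftrightarrow> submodule N R' X'"
  using assms by (simp add: submodule_def submodule_axioms_def subgroup_def m_inv_def)

lemma left_ideal_opposite: "left_ideal I (opposite_ring R) \<longleftrightarrow> right_ideal I R"
  by (rule submodule_cong) (simp_all add: left_regular_def right_regular_def fun_eq_iff)

lemma right_ideal_opposite: "right_ideal I (opposite_ring R) \<longleftrightarrow> left_ideal I R"
  by (rule submodule_cong) (simp_all add: left_regular_def right_regular_def fun_eq_iff)

lemma (in ring) right_ideal_iff:
  "right_ideal I R \<longleftrightarrow> I \<subseteq> carrier R \<and> \<zero> \<in> I \<and> (\<forall>x\<in>I. \<forall>y\<in>I. x \<oplus> y \<in> I) \<and>
    (\<forall>a\<in>carrier R. \<forall>x\<in>I. x \<otimes> a \<in> I)"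
  using ring.left_ideal_iff[OF ring_opposite, of I] by (simp add: left_ideal_opposite)

lemma quasi_Frobenius_opposite:
  assumes "quasi_Frobenius_ring R" shows "quasi_Frobenius_ring (opposite_ring R)"
  using assms ring.ring_opposite[of R]
  by (simp add: quasi_Frobenius_ring_def artinian_module_def left_ideal_opposite
    right_ideal_opposite left_annihilator_def right_annihilator_def)

text \<open>The descending chain condition in the form of a minimum principle: without a minimal
  element, dependent choice would give a strictly descending sequence.\<close>

lemma artinian_module_minimal:
  assumes art: "artinian_module R X" and ne: "\<N> \<noteq> {}"
    and sub: "\<And>N. N \<in> \<N> \<Longrightarrow> submodule N R X"
  shows "\<exists>N\<in>\<N>. \<forall>N'\<in>\<N>. N' \<subseteq> N \<longrightarrow> N' = N"
proof (rule ccontr)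
  assume "\<not> ?thesis"
  then have "\<exists>N'. N' \<in> \<N> \<and> N' \<subset> N" if "N \<in> \<N>" for N
    using that by (metis psubsetI)
  then obtain next_below where nb: "\<And>N. N \<in> \<N> \<Longrightarrow> next_below N \<in> \<N> \<and> next_below N \<subset> N"
    by metis
  from ne obtain N0 where N0: "N0 \<in> \<N>" by blast
  define C where "C i = (next_below ^^ i) N0" for i
  have C: "C i \<in> \<N>" for i
    by (induction i) (simp_all add: C_def N0 nb)
  have strict: "C (Suc i) \<subset> C i" for i
    using nb[OF C[of i]] by (simp add: C_def)
  then have "antimono C"
    by (simp add: antimono_iff_le_Suc less_imp_le)
  then obtain n where "\<forall>m\<ge>n. C m = C n"
    using art C sub unfolding artinian_module_def by blast
  then show False
    using strict[of n] by (metis le_SucI order_refl psubset_eq)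
qed

section \<open>Functionals on one-sided ideals of a quasi-Frobenius ring\<close>

context ring
begin

lemma left_ideal_principal:
  assumes "x \<in> carrier R" shows "left_ideal {a \<otimes> x | a. a \<in> carrier R} R"
  using left_module.submodule_cyclic[OF left_module_left_regular[OF ring_axioms], of x] assms
  by (simp add: left_regular_def)

lemma set_add_left_regular: "A <+>\<^bsub>left_regular S\<^esub> B = A <+>\<^bsub>S\<^esub> B"
  by (simp add: set_add_def' left_regular_def)

lemma left_ideal_set_add:
  assumes "left_ideal A R" "left_ideal B R"
  shows "left_ideal (A <+>\<^bsub>R\<^esub> B) R" "A \<subseteq> A <+>\<^bsub>R\<^esub> B" "B \<subseteq> A <+>\<^bsub>R\<^esub> B"
  using left_module.submodule_set_add[OF left_module_left_regular[OF ring_axioms], of A B]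
    left_module.subset_set_add[OF left_module_left_regular[OF ring_axioms], of A B] assms
  by (simp_all add: set_add_left_regular)

lemma right_ideal_principal:
  assumes "x \<in> carrier R" shows "right_ideal {x \<otimes> a | a. a \<in> carrier R} R"
  using ring.left_ideal_principal[OF ring_opposite, of x] assms by (simp add: left_ideal_opposite)

lemma right_ideal_set_add:
  assumes "right_ideal A R" "right_ideal B R"
  shows "right_ideal (A <+>\<^bsub>R\<^esub> B) R" "A \<subseteq> A <+>\<^bsub>R\<^esub> B" "B \<subseteq> A <+>\<^bsub>R\<^esub> B"
proof -
  have "A <+>\<^bsub>opposite_ring R\<^esub> B = A <+>\<^bsub>R\<^esub> B"
    by (simp add: set_add_def')
  then show "right_ideal (A <+>\<^bsub>R\<^esub> B) R" "A \<subseteq> A <+>\<^bsub>R\<^esub> B" "B \<subseteq> A <+>\<^bsub>R\<^esub> B"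
    using ring.left_ideal_set_add[OF ring_opposite, of A B] assms
    by (simp_all add: left_ideal_opposite)
qed

lemma right_ideal_right_annihilator:
  assumes "A \<subseteq> carrier R" shows "right_ideal (right_annihilator R A) R"
  using assms unfolding right_ideal_iff right_annihilator_def
  by (auto simp: r_distr m_assoc[symmetric] subset_iff)

text \<open>The left annihilator of a sum is contained in both left annihilators; hence that of
  \<open>r(A) + r(B)\<close> lies in \<open>A \<inter> B\<close>, by the double annihilator condition for \<open>A\<close> and \<open>B\<close>. Taking right
  annihilators, and using the condition for the right ideal \<open>r(A) + r(B)\<close>, gives the claim.\<close>

lemma right_annihilator_Int:
  assumes QF: "quasi_Frobenius_ring R" and A: "left_ideal A R" and B: "left_ideal B R"
  shows "right_annihilator R (A \<inter> B) \<subseteq> right_annihilator R A <+>\<^bsub>R\<^esub> right_annihilator R B"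
proof -
  let ?S = "right_annihilator R A <+>\<^bsub>R\<^esub> right_annihilator R B"
  have lr: "\<And>J. left_ideal J R \<Longrightarrow> left_annihilator R (right_annihilator R J) = J"
    and rl: "\<And>J. right_ideal J R \<Longrightarrow> right_annihilator R (left_annihilator R J) = J"
    using QF by (auto simp: quasi_Frobenius_ring_def)
  have "A \<subseteq> carrier R" "B \<subseteq> carrier R"
    using A B by (auto simp: left_ideal_iff)
  note S = right_ideal_set_add[OF this[THEN right_ideal_right_annihilator]]
  have "left_annihilator R ?S \<subseteq> left_annihilator R (right_annihilator R A)"
    "left_annihilator R ?S \<subseteq> left_annihilator R (right_annihilator R B)"
    using S(2,3) unfolding left_annihilator_def by blast+
  then have "left_annihilator R ?S \<subseteq> A \<inter> B"
    using lr[OF A] lr[OF B] by simp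
  then have "right_annihilator R (A \<inter> B) \<subseteq> right_annihilator R (left_annihilator R ?S)"
    unfolding right_annihilator_def by blast
  then show ?thesis using rl[OF S(1)] by simp
qed

text \<open>This is the condition in Baer's criterion, for \<open>R\<close> as a left module over itself. Consider the
  left ideals inside \<open>I\<close> on which \<open>\<phi>\<close> is a right multiplication. Such an ideal \<open>J\<close> can be enlarged by
  any \<open>x\<close> in \<open>I\<close>: the multipliers \<open>c\<close> on \<open>J\<close> and \<open>d\<close> on \<open>R x\<close> differ by an element that annihilates
  \<open>J \<inter> R x\<close>, so by \<open>right_annihilator_Int\<close> they can be corrected to a common multiplier \<open>e\<close>. The
  descending chain condition for right ideals provides a \<open>J\<close> with minimal right annihilator;
  enlarging it leaves the annihilator unchanged, hence also \<open>J\<close> itself, being the left annihilator of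
  that annihilator. So \<open>J = I\<close>.\<close>

lemma functional_on_left_ideal:
  assumes QF: "quasi_Frobenius_ring R" and I: "left_ideal I R"
    and f: "functional_on R (left_regular R) I \<phi>"
  obtains c where "c \<in> carrier R" "\<And>r. r \<in> I \<Longrightarrow> \<phi> r = r \<otimes> c"
proof -
  have fD: "\<And>x. x \<in> I \<Longrightarrow> \<phi> x \<in> carrier R"
      "\<And>x y. \<lbrakk>x \<in> I; y \<in> I\<rbrakk> \<Longrightarrow> \<phi> (x \<oplus> y) = \<phi> x \<oplus> \<phi> y"
      "\<And>a x. \<lbrakk>a \<in> carrier R; x \<in> I\<rbrakk> \<Longrightarrow> \<phi> (a \<otimes> x) = a \<otimes> \<phi> x"
    using functional_onD[OF f] by (auto simp: left_regular_def)
  have ID: "\<zero> \<in> I" "\<And>x. x \<in> I \<Longrightarrow> x \<in> carrier R"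
      "\<And>x y. \<lbrakk>x \<in> I; y \<in> I\<rbrakk> \<Longrightarrow> x \<oplus> y \<in> I" "\<And>a x. \<lbrakk>a \<in> carrier R; x \<in> I\<rbrakk> \<Longrightarrow> a \<otimes> x \<in> I"
    using I by (auto simp: left_ideal_iff)
  have art: "artinian_module R (right_regular R)"
    and lr: "\<And>J. left_ideal J R \<Longrightarrow> left_annihilator R (right_annihilator R J) = J"
    and rl: "\<And>J. right_ideal J R \<Longrightarrow> right_annihilator R (left_annihilator R J) = J"
    using QF by (auto simp: quasi_Frobenius_ring_def)
  define F where "F = {J. left_ideal J R \<and> J \<subseteq> I \<and> (\<exists>c\<in>carrier R. \<forall>r\<in>J. \<phi> r = r \<otimes> c)}"
  have "\<phi> \<zero> = \<zero>"
    using fD(3)[of \<zero> \<zero>] fD(1)[of \<zero>] ID by simp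
  then have "{\<zero>} \<in> F"
    using ID by (auto simp: F_def left_ideal_iff intro!: bexI[of _ \<zero>])
  have step: "\<exists>J'\<in>F. J \<subseteq> J' \<and> x \<in> J'" if J: "J \<in> F" and x: "x \<in> I" for J x
  proof -
    from J obtain c where c: "c \<in> carrier R" "\<And>r. r \<in> J \<Longrightarrow> \<phi> r = r \<otimes> c"
      and JI: "left_ideal J R" "J \<subseteq> I"
      by (auto simp: F_def)
    have JD: "\<And>y. y \<in> J \<Longrightarrow> y \<in> carrier R"
      using JI by (auto simp: left_ideal_iff)
    have xR: "x \<in> carrier R" using x ID by simp
    \<comment> \<open>Whatever kills \<open>x\<close> from the left kills \<open>\<phi> x\<close>, so \<open>\<phi> x\<close> lies in the double annihilator of
      \<open>x R\<close>, which is \<open>x R\<close> itself: this gives the multiplier \<open>d\<close> on \<open>R x\<close>.\<close>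
    let ?xR = "{x \<otimes> a | a. a \<in> carrier R}" and ?Rx = "{a \<otimes> x | a. a \<in> carrier R}"
    have "right_ideal ?xR R" using xR by (rule right_ideal_principal)
    moreover have "\<phi> x \<in> right_annihilator R (left_annihilator R ?xR)"
    proof -
      have "r \<otimes> \<phi> x = \<zero>" if r: "r \<in> left_annihilator R ?xR" for r
      proof -
        have rR: "r \<in> carrier R" and "r \<otimes> (x \<otimes> \<one>) = \<zero>"
          using r xR unfolding left_annihilator_def by blast+
        then have "r \<otimes> x = \<zero>" using xR by simp
        then show ?thesis using fD(3)[OF rR x] \<open>\<phi> \<zero> = \<zero>\<close> by simp
      qed
      then show ?thesis using fD(1)[OF x] by (simp add: right_annihilator_def)
    qed
    ultimately obtain d where d: "d \<in> carrier R" "\<phi> x = x \<otimes> d"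
      using rl by auto
    have Rx: "left_ideal ?Rx R" using xR by (rule left_ideal_principal)
    have "c \<ominus> d \<in> right_annihilator R (J \<inter> ?Rx)"
    proof -
      have "y \<otimes> (c \<ominus> d) = \<zero>" if y: "y \<in> J" "y = a \<otimes> x" "a \<in> carrier R" for y a
      proof -
        have "y \<otimes> c = y \<otimes> d"
          using c(2)[OF y(1)] fD(3)[OF y(3) x] d y xR by (simp add: m_assoc)
        then show ?thesis
          using c d JD[OF y(1)] by (simp add: minus_eq r_distr r_minus r_neg)
      qed
      then show ?thesis
        using c d by (auto simp: right_annihilator_def)
    qed
    then obtain a b where ab: "a \<in> right_annihilator R J" "b \<in> right_annihilator R ?Rx"
      "c \<ominus> d = a \<oplus> b"
      using right_annihilator_Int[OF QF JI(1) Rx] unfolding set_add_def' by blast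
    then have abR: "a \<in> carrier R" "b \<in> carrier R" by (auto simp: right_annihilator_def)
    \<comment> \<open>\<open>e = c - a = d + b\<close> acts like \<open>c\<close> on \<open>J\<close> and like \<open>d\<close> on \<open>R x\<close>.\<close>
    define e where "e = d \<oplus> b"
    have e: "e \<in> carrier R" "c = a \<oplus> e"
      using ab(3) add_minus_cancel[of d c] c d abR by (auto simp: e_def a_ac)
    have eJ: "\<phi> j = j \<otimes> e" if "j \<in> J" for j
      using that ab(1) c JD e abR by (simp add: right_annihilator_def r_distr)
    have ex: "\<phi> x = x \<otimes> e"
    proof -
      have "\<one> \<otimes> x \<in> ?Rx" by blast
      then have "x \<otimes> b = \<zero>" using ab(2) xR by (simp add: right_annihilator_def)
      then show ?thesis using d xR abR by (simp add: e_def r_distr)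
    qed
    let ?J = "J <+>\<^bsub>R\<^esub> ?Rx"
    note J' = left_ideal_set_add[OF JI(1) Rx]
    have "?J \<subseteq> I" using JI(2) ID(3,4) x unfolding set_add_def' by blast
    moreover have "\<phi> y = y \<otimes> e" if "y \<in> ?J" for y
    proof -
      from that obtain j r where jr: "j \<in> J" "r \<in> carrier R" "y = j \<oplus> r \<otimes> x"
        unfolding set_add_def' by blast
      then have "\<phi> y = \<phi> j \<oplus> r \<otimes> \<phi> x"
        using JI(2) fD(2,3) ID(4) x by (simp add: subset_iff)
      then show ?thesis
        using jr e xR JD by (simp add: eJ ex l_distr m_assoc)
    qed
    ultimately have "?J \<in> F" using e(1) J'(1) by (auto simp: F_def)
    moreover have "x \<in> ?J"
    proof -
      have "\<one> \<otimes> x \<in> ?Rx" by blast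
      then show ?thesis using J'(3) xR by auto
    qed
    ultimately show ?thesis using J'(2) by blast
  qed
  obtain J where J: "J \<in> F"
    and min: "\<And>J'. \<lbrakk>J' \<in> F; right_annihilator R J' \<subseteq> right_annihilator R J\<rbrakk>
      \<Longrightarrow> right_annihilator R J' = right_annihilator R J"
  proof -
    have "\<exists>N\<in>right_annihilator R ` F. \<forall>N'\<in>right_annihilator R ` F. N' \<subseteq> N \<longrightarrow> N' = N"
    proof (rule artinian_module_minimal[OF art])
      show "right_annihilator R ` F \<noteq> {}" using \<open>{\<zero>} \<in> F\<close> by blast
    next
      fix N assume "N \<in> right_annihilator R ` F"
      then obtain J where N: "N = right_annihilator R J" and "J \<in> F" by blast
      then have "J \<subseteq> carrier R" by (simp add: F_def left_ideal_iff)
      then show "right_ideal N R" unfolding N by (rule right_ideal_right_annihilator)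
    qed
    then obtain J where J: "J \<in> F" and
      min: "\<forall>N'\<in>right_annihilator R ` F. N' \<subseteq> right_annihilator R J \<longrightarrow> N' = right_annihilator R J"
      by (elim bexE imageE) simp
    show ?thesis by (rule that[OF J]) (use min in simp)
  qed
  have "I \<subseteq> J"
  proof
    fix x assume "x \<in> I"
    then obtain J' where J': "J' \<in> F" "J \<subseteq> J'" "x \<in> J'" using step[OF J] by blast
    then have "right_annihilator R J' = right_annihilator R J"
      by (intro min) (auto simp: right_annihilator_def)
    then have "J' = J" using lr J J'(1) by (metis (lifting) F_def mem_Collect_eq)
    then show "x \<in> J" using J'(3) by simp
  qed
  then show thesis using J that by (auto simp: F_def)
qed

lemma proper_left_ideal_annihilated:
  assumes QF: "quasi_Frobenius_ring R" and I: "left_ideal I R" "\<one> \<notin> I"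
  obtains c where "c \<in> carrier R" "c \<noteq> \<zero>" "\<And>r. r \<in> I \<Longrightarrow> r \<otimes> c = \<zero>"
proof -
  have "left_annihilator R (right_annihilator R I) = I"
    using QF I by (auto simp: quasi_Frobenius_ring_def)
  then obtain c where "c \<in> right_annihilator R I" "\<one> \<otimes> c \<noteq> \<zero>"
    using I(2) unfolding left_annihilator_def by blast
  then show thesis
    by (intro that[of c]) (auto simp: right_annihilator_def)
qed

end

section \<open>Extending and separating functionals\<close>

lemma (in left_module) left_ideal_transporter:
  assumes "submodule N R M" "m \<in> carrier M"
  shows "left_ideal {r \<in> carrier R. r \<odot>\<^bsub>M\<^esub> m \<in> N} R"
  using assms submoduleD[OF assms(1)]
  by (auto simp: R.left_ideal_iff smult_l_distr smult_assoc)

text \<open>Adjoining a generator \<open>m\<close> asks for a value at \<open>m\<close> compatible with the values at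
  the multiples \<open>r m\<close> where the functional is already defined. These \<open>r\<close> form a left ideal, and the
  multiplier of \<open>r \<mapsto> \<psi> (r m)\<close> on it is such a value.\<close>

lemma (in left_module) functional_extend_finite:
  assumes QF: "quasi_Frobenius_ring R" and "finite A" "A \<subseteq> carrier M"
    and N: "submodule N R M" and f: "functional_on R M N \<phi>"
  shows "\<exists>N' \<phi>'. submodule N' R M \<and> N \<subseteq> N' \<and> A \<subseteq> N' \<and> functional_on R M N' \<phi>' \<and>
    (\<forall>x\<in>N. \<phi>' x = \<phi> x)"
  using assms(2,3)
proof (induction A)
  case empty
  then show ?case using N f by blast
next
  case (insert m A)
  then obtain K \<psi> where K: "submodule K R M" "N \<subseteq> K" "A \<subseteq> K" "functional_on R M K \<psi>"
    "\<And>x. x \<in> N \<Longrightarrow> \<psi> x = \<phi> x"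
    by blast
  have m: "m \<in> carrier M" using insert.prems by simp
  let ?I = "{r \<in> carrier R. r \<odot>\<^bsub>M\<^esub> m \<in> K}"
  have "functional_on R (left_regular R) ?I (\<lambda>r. \<psi> (r \<odot>\<^bsub>M\<^esub> m))"
    using functional_onD[OF K(4)] m
    by (auto simp: functional_on_def left_regular_def smult_l_distr smult_assoc)
  then obtain c where c: "c \<in> carrier R" "\<And>r. r \<in> ?I \<Longrightarrow> \<psi> (r \<odot>\<^bsub>M\<^esub> m) = r \<otimes> c"
    using R.functional_on_left_ideal[OF QF left_ideal_transporter[OF K(1) m]] by blast
  have compat: "\<And>r. \<lbrakk>r \<in> carrier R; r \<odot>\<^bsub>M\<^esub> m \<in> K\<rbrakk> \<Longrightarrow> \<psi> (r \<odot>\<^bsub>M\<^esub> m) = r \<otimes> c"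
    using c(2) by simp
  obtain N' \<phi>' where N': "submodule N' R M" "K \<subseteq> N'" "m \<in> N'" "functional_on R M N' \<phi>'"
    "\<And>x. x \<in> K \<Longrightarrow> \<phi>' x = \<psi> x"
    using functional_adjoin[OF K(1,4) m c(1) compat] by blast
  have "submodule N' R M \<and> N \<subseteq> N' \<and> insert m A \<subseteq> N' \<and> functional_on R M N' \<phi>' \<and>
    (\<forall>x\<in>N. \<phi>' x = \<phi> x)"
    using N' K by (simp add: subset_iff)
  then show ?case by blast
qed

text \<open>The \<open>r\<close> with \<open>r x\<close> in \<open>N\<close> form a proper left ideal, which some \<open>c \<noteq> 0\<close> annihilates. So the zero
  functional on \<open>N\<close> can be extended to \<open>N + R x\<close> with the value \<open>c\<close> at \<open>x\<close>.\<close>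

lemma (in left_module) functional_separate:
  assumes QF: "quasi_Frobenius_ring R" and N: "submodule N R M"
    and x: "x \<in> carrier M" "x \<notin> N"
  obtains N' \<phi> where "submodule N' R M" "N \<subseteq> N'" "x \<in> N'" "functional_on R M N' \<phi>"
    "\<And>n. n \<in> N \<Longrightarrow> \<phi> n = \<zero>" "\<phi> x \<noteq> \<zero>"
proof -
  have "\<one> \<notin> {r \<in> carrier R. r \<odot>\<^bsub>M\<^esub> x \<in> N}" using x by simp
  then obtain c where c: "c \<in> carrier R" "c \<noteq> \<zero>"
    and ann: "\<And>r. r \<in> {r \<in> carrier R. r \<odot>\<^bsub>M\<^esub> x \<in> N} \<Longrightarrow> r \<otimes> c = \<zero>"
    using R.proper_left_ideal_annihilated[OF QF left_ideal_transporter[OF N x(1)]] by blast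
  have f: "functional_on R M N (\<lambda>_. \<zero>)"
    by (simp add: functional_on_def)
  have "\<And>r. \<lbrakk>r \<in> carrier R; r \<odot>\<^bsub>M\<^esub> x \<in> N\<rbrakk> \<Longrightarrow> \<zero> = r \<otimes> c"
    using ann by simp
  then show thesis
    using functional_adjoin[OF N f x(1) c(1)] that c(2) by metis
qed

lemma finitely_generated_moduleE:
  assumes "finitely_generated_module R X"
  obtains A where "finite A" "A \<subseteq> carrier X"
    "\<And>N. \<lbrakk>submodule N R X; A \<subseteq> N\<rbrakk> \<Longrightarrow> carrier X \<subseteq> N"
  using assms unfolding finitely_generated_module_def by blast

section \<open>The dual of a finitely generated module\<close>

lemma dual_module_simps:
  "carrier (dual_module R M) = module_homs R M (left_regular R)"
  "f \<oplus>\<^bsub>dual_module R M\<^esub> g = (\<lambda>x\<in>carrier M. f x \<oplus>\<^bsub>R\<^esub> g x)"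
  "a \<odot>\<^bsub>dual_module R M\<^esub> f = (\<lambda>x\<in>carrier M. f x \<otimes>\<^bsub>R\<^esub> a)"
  "\<zero>\<^bsub>dual_module R M\<^esub> = (\<lambda>x\<in>carrier M. \<zero>\<^bsub>R\<^esub>)"
  by (simp_all add: dual_module_def)

lemma right_module_opposite:
  assumes "right_module R X" shows "left_module (opposite_ring R) X"
proof -
  interpret right_module R X by fact
  interpret op: ring "opposite_ring R" by (rule R.ring_opposite)
  show ?thesis
    by unfold_locales (simp_all add: smult_l_distr smult_r_distr smult_assoc)
qed

lemma submodule_opposite: "submodule N (opposite_ring R) X \<longleftrightarrow> submodule N R X"
  by (rule submodule_cong) simp_all

context left_module
begin

abbreviation "M_dual \<equiv> dual_module R M"

lemma dual_left_module: "left_module (opposite_ring R) M_dual"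
  by (rule right_module_opposite[OF right_module_dual])

lemma dualD:
  assumes "g \<in> carrier M_dual"
  shows "x \<in> carrier M \<Longrightarrow> g x \<in> carrier R"
    and "\<lbrakk>x \<in> carrier M; y \<in> carrier M\<rbrakk> \<Longrightarrow> g (x \<oplus>\<^bsub>M\<^esub> y) = g x \<oplus> g y"
    and "\<lbrakk>a \<in> carrier R; x \<in> carrier M\<rbrakk> \<Longrightarrow> g (a \<odot>\<^bsub>M\<^esub> x) = a \<otimes> g x"
    and "g \<in> extensional (carrier M)"
  using assms by (auto simp: mem_dual_iff)

lemma functional_on_dual: "g \<in> carrier M_dual \<Longrightarrow> functional_on R M (carrier M) g"
  by (simp add: functional_on_def dualD)

lemma submodule_carrier: "submodule (carrier M) R M"
  by (simp add: submodule_iff)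

lemma dual_zero: "g \<in> carrier M_dual \<Longrightarrow> g \<zero>\<^bsub>M\<^esub> = \<zero>"
  using functional_zero[OF submodule_carrier functional_on_dual] .

lemma dual_submoduleD:
  assumes "submodule L R M_dual"
  shows "g \<in> L \<Longrightarrow> g \<in> carrier M_dual" and "\<zero>\<^bsub>M_dual\<^esub> \<in> L"
    and "\<lbrakk>g \<in> L; h \<in> L\<rbrakk> \<Longrightarrow> g \<oplus>\<^bsub>M_dual\<^esub> h \<in> L"
    and "\<lbrakk>a \<in> carrier R; g \<in> L\<rbrakk> \<Longrightarrow> a \<odot>\<^bsub>M_dual\<^esub> g \<in> L"
  using left_module.submoduleD[OF dual_left_module, of L] assms by (simp_all add: submodule_opposite)

lemma dual_separates:
  assumes QF: "quasi_Frobenius_ring R" and fg: "finitely_generated_module R M"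
    and N: "submodule N R M" and x: "x \<in> carrier M" "x \<notin> N"
  obtains g where "g \<in> carrier M_dual" "\<And>n. n \<in> N \<Longrightarrow> g n = \<zero>" "g x \<noteq> \<zero>"
proof -
  obtain A where A: "finite A" "A \<subseteq> carrier M"
    "\<And>N. \<lbrakk>submodule N R M; A \<subseteq> N\<rbrakk> \<Longrightarrow> carrier M \<subseteq> N"
    using finitely_generated_moduleE[OF fg] by blast
  obtain K \<phi> where K: "submodule K R M" "N \<subseteq> K" "x \<in> K" "functional_on R M K \<phi>"
    "\<And>n. n \<in> N \<Longrightarrow> \<phi> n = \<zero>" "\<phi> x \<noteq> \<zero>"
    using functional_separate[OF QF N x] by blast
  obtain N' \<psi> where N': "submodule N' R M" "A \<subseteq> N'" "functional_on R M N' \<psi>"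
    "\<And>y. y \<in> K \<Longrightarrow> \<psi> y = \<phi> y"
    using functional_extend_finite[OF QF A(1,2) K(1,4)] by blast
  have "functional_on R M (carrier M) \<psi>"
    using N'(3) A(3)[OF N'(1,2)] submoduleD(1)[OF N'(1)] by (metis subsetI subset_antisym)
  then have "restrict \<psi> (carrier M) \<in> carrier M_dual"
    by (simp add: mem_dual_iff functional_on_def)
  then show thesis
  proof (rule that)
    show "restrict \<psi> (carrier M) n = \<zero>" if "n \<in> N" for n
      using that K(2,5) N'(4) submoduleD(1)[OF N that] by auto
    show "restrict \<psi> (carrier M) x \<noteq> \<zero>"
      using K(3,6) N'(4) x(1) by simp
  qed
qed

lemma dual_separates_points:
  assumes QF: "quasi_Frobenius_ring R" and fg: "finitely_generated_module R M"
    and xy: "x \<in> carrier M" "y \<in> carrier M" and eq: "\<And>g. g \<in> carrier M_dual \<Longrightarrow> g x = g y"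
  shows "x = y"
proof (rule ccontr)
  assume "x \<noteq> y"
  let ?d = "x \<oplus>\<^bsub>M\<^esub> \<ominus>\<^bsub>M\<^esub> y"
  have "?d \<noteq> \<zero>\<^bsub>M\<^esub>"
    using \<open>x \<noteq> y\<close> xy by (metis M.minus_equality M.minus_minus M.a_inv_closed)
  moreover have "submodule {\<zero>\<^bsub>M\<^esub>} R M" by (simp add: submodule_iff)
  ultimately obtain g where g: "g \<in> carrier M_dual" "g ?d \<noteq> \<zero>"
    using dual_separates[OF QF fg, of "{\<zero>\<^bsub>M\<^esub>}" ?d] xy by auto
  have "g ?d = g x \<oplus> \<ominus> g y"
    using xy dualD(2)[OF g(1), of x "\<ominus>\<^bsub>M\<^esub> y"]
      functional_minus[OF submodule_carrier functional_on_dual[OF g(1)], of y] by simp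
  then show False using g eq[OF g(1)] dualD(1)[OF g(1)] xy by (simp add: R.r_neg)
qed

text \<open>The module-theoretic version of a fact from linear algebra: a functional that vanishes on
  the common kernel of finitely many functionals, here the evaluations at the points of \<open>A\<close>, is a
  linear combination of them, and a combination of evaluations is evaluation at a point. In the
  induction, \<open>y\<close> serves on the kernel of the evaluation at the new point \<open>a\<close>; the error \<open>\<chi>\<close> vanishes
  on this kernel, hence factors through \<open>g \<mapsto> g a\<close> as a functional \<open>\<theta>\<close> on a right ideal, which is
  left multiplication by some \<open>c\<close>. Then \<open>y + c a\<close> serves on all of \<open>L\<close>. The submodule \<open>L\<close> varies
  because the induction hypothesis is used for that kernel.\<close>

lemma functional_vanishing_on_common_zeros_is_evaluation:
  assumes QF: "quasi_Frobenius_ring R" and "finite A" "A \<subseteq> carrier M"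
    and L: "submodule L R M_dual" and "functional_on (opposite_ring R) M_dual L \<psi>"
    and "\<And>g. \<lbrakk>g \<in> L; \<And>a. a \<in> A \<Longrightarrow> g a = \<zero>\<rbrakk> \<Longrightarrow> \<psi> g = \<zero>"
  shows "\<exists>x\<in>carrier M. \<forall>g\<in>L. \<psi> g = g x"
  using assms(2-)
proof (induction A arbitrary: L \<psi>)
  case empty
  then show ?case
    by (intro bexI[of _ "\<zero>\<^bsub>M\<^esub>"] ballI) (simp_all add: dual_zero dual_submoduleD)
next
  case (insert a A)
  note L = insert.prems(2) and f = insert.prems(3)
  note LD = dual_submoduleD[OF L]
  have a: "a \<in> carrier M" using insert.prems(1) by simp
  note fD = functional_onD[OF f, simplified]
  let ?K = "{g \<in> L. g a = \<zero>}"
  have "submodule ?K (opposite_ring R) M_dual"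
    unfolding left_module.submodule_iff[OF dual_left_module]
    using LD a by (auto simp: dual_module_simps)
  then have K: "submodule ?K R M_dual" by (simp add: submodule_opposite)
  have "\<exists>y\<in>carrier M. \<forall>g\<in>?K. \<psi> g = g y"
    using insert.prems(1,4) f by (intro insert.IH K) (auto simp: functional_on_def)
  then obtain y where y: "y \<in> carrier M" and yK: "\<And>g. \<lbrakk>g \<in> L; g a = \<zero>\<rbrakk> \<Longrightarrow> \<psi> g = g y"
    by auto
  define \<chi> where "\<chi> g = \<psi> g \<ominus> g y" for g
  have \<chi>: "functional_on (opposite_ring R) M_dual L \<chi>"
    unfolding functional_on_def
  proof (intro conjI ballI)
    fix g h assume gh: "g \<in> L" "h \<in> L"
    then have "(g \<oplus>\<^bsub>M_dual\<^esub> h) y = g y \<oplus> h y" using y by (simp add: dual_module_simps)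
    then show "\<chi> (g \<oplus>\<^bsub>M_dual\<^esub> h) = \<chi> g \<oplus>\<^bsub>opposite_ring R\<^esub> \<chi> h"
      using gh fD(1,2) dualD(1)[OF LD(1) y]
      by (simp add: \<chi>_def R.minus_eq R.minus_add R.a_ac)
  next
    fix r g assume rg: "r \<in> carrier (opposite_ring R)" "g \<in> L"
    then have "(r \<odot>\<^bsub>M_dual\<^esub> g) y = g y \<otimes> r" using y by (simp add: dual_module_simps)
    then show "\<chi> (r \<odot>\<^bsub>M_dual\<^esub> g) = r \<otimes>\<^bsub>opposite_ring R\<^esub> \<chi> g"
      using rg fD(1,3) dualD(1)[OF LD(1) y]
      by (simp add: \<chi>_def R.minus_eq R.l_distr R.l_minus)
  qed (use fD(1) dualD(1)[OF LD(1) y] in \<open>simp add: \<chi>_def\<close>)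
  note \<chi>D = functional_onD[OF \<chi>, simplified]
  have \<chi>K: "\<chi> g = \<zero>" if "g \<in> L" "g a = \<zero>" for g
    using yK[OF that] dualD(1)[OF LD(1)[OF that(1)] y] by (simp add: \<chi>_def R.minus_eq R.r_neg)
  have inj: "\<chi> g = \<chi> h" if gh: "g \<in> L" "h \<in> L" "g a = h a" for g h
  proof -
    let ?n = "\<ominus>\<^bsub>M_dual\<^esub> h"
    have Lop: "submodule L (opposite_ring R) M_dual" using L by (simp add: submodule_opposite)
    have n: "?n \<in> L" by (rule left_module.submodule_minus[OF dual_left_module Lop gh(2)])
    have "?n \<oplus>\<^bsub>M_dual\<^esub> h = \<zero>\<^bsub>M_dual\<^esub>"
      by (rule abelian_group.l_neg[OF left_module.axioms(2)[OF dual_left_module] LD(1)[OF gh(2)]])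
    then have "(?n \<oplus>\<^bsub>M_dual\<^esub> h) a = \<zero>\<^bsub>M_dual\<^esub> a"
      by (rule arg_cong)
    then have "(?n \<oplus>\<^bsub>M_dual\<^esub> g) a = \<zero>"
      unfolding dual_module_simps using a gh(3) by simp
    then have "\<chi> ?n \<oplus> \<chi> g = \<zero>"
      using \<chi>K[of "?n \<oplus>\<^bsub>M_dual\<^esub> g"] LD(3)[OF n gh(1)] \<chi>D(2)[OF n gh(1)] by simp
    then have "\<ominus> \<chi> h \<oplus> \<chi> g = \<zero>"
      using left_module.functional_minus[OF dual_left_module Lop \<chi> gh(2)] by simp
    then show ?thesis
      using \<chi>D(1) gh(1,2) by (metis R.minus_equality R.minus_minus R.a_comm R.a_inv_closed)
  qed
  let ?I = "{g a | g. g \<in> L}"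
  define \<theta> where "\<theta> r = \<chi> (SOME g. g \<in> L \<and> g a = r)" for r
  have \<theta>: "\<theta> (g a) = \<chi> g" if "g \<in> L" for g
    unfolding \<theta>_def using someI[of "\<lambda>h. h \<in> L \<and> h a = g a" g] that by (intro inj) auto
  have Ia: "g a \<oplus> h a = (g \<oplus>\<^bsub>M_dual\<^esub> h) a" "g a \<otimes> r = (r \<odot>\<^bsub>M_dual\<^esub> g) a" for g h r
    using a by (simp_all add: dual_module_simps)
  have I0: "\<zero> = \<zero>\<^bsub>M_dual\<^esub> a" using a by (simp add: dual_module_simps)
  have "left_ideal ?I (opposite_ring R)"
    unfolding left_ideal_opposite R.right_ideal_iff
  proof (intro conjI ballI)
    show "?I \<subseteq> carrier R" using dualD(1)[OF LD(1) a] by auto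
    show "\<zero> \<in> ?I" using I0 LD(2) by blast
  next
    fix r s assume "r \<in> ?I" "s \<in> ?I"
    then show "r \<oplus> s \<in> ?I" using Ia(1) LD(3) by auto
  next
    fix r s assume "r \<in> carrier R" "s \<in> ?I"
    then show "s \<otimes> r \<in> ?I" using Ia(2) LD(4) by auto
  qed
  moreover have "functional_on (opposite_ring R) (left_regular (opposite_ring R)) ?I \<theta>"
    unfolding functional_on_def
  proof (intro conjI ballI)
    fix r assume "r \<in> ?I"
    then show "\<theta> r \<in> carrier (opposite_ring R)" using \<theta> \<chi>D(1) by auto
  next
    fix r s assume "r \<in> ?I" "s \<in> ?I"
    then obtain g h where "g \<in> L" "h \<in> L" and rs: "r = g a" "s = h a" by blast
    then show "\<theta> (r \<oplus>\<^bsub>left_regular (opposite_ring R)\<^esub> s) = \<theta> r \<oplus>\<^bsub>opposite_ring R\<^esub> \<theta> s"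
      by (simp add: left_regular_def Ia(1) \<theta> \<chi>D LD)
  next
    fix r s assume r: "r \<in> carrier (opposite_ring R)" and "s \<in> ?I"
    then obtain g where "g \<in> L" and s: "s = g a" by blast
    then show "\<theta> (r \<odot>\<^bsub>left_regular (opposite_ring R)\<^esub> s) = r \<otimes>\<^bsub>opposite_ring R\<^esub> \<theta> s"
      using r by (simp add: left_regular_def Ia(2) \<theta> \<chi>D LD)
  qed
  ultimately obtain c where "c \<in> carrier (opposite_ring R)"
      "\<And>r. r \<in> ?I \<Longrightarrow> \<theta> r = r \<otimes>\<^bsub>opposite_ring R\<^esub> c"
    using ring.functional_on_left_ideal[OF R.ring_opposite quasi_Frobenius_opposite[OF QF]] by blast
  then have c: "c \<in> carrier R" and c\<theta>: "\<And>g. g \<in> L \<Longrightarrow> \<theta> (g a) = c \<otimes> g a"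
    by auto
  show ?case
  proof (intro bexI ballI)
    show "y \<oplus>\<^bsub>M\<^esub> c \<odot>\<^bsub>M\<^esub> a \<in> carrier M" using y c a by simp
    fix g assume g: "g \<in> L"
    note gD = dualD[OF LD(1)[OF g]]
    have "g (y \<oplus>\<^bsub>M\<^esub> c \<odot>\<^bsub>M\<^esub> a) = g y \<oplus> \<chi> g"
      using gD y c a c\<theta>[OF g] \<theta>[OF g] by simp
    also have "\<dots> = \<psi> g"
      unfolding \<chi>_def using gD(1)[OF y] fD(1)[OF g] by (rule R.add_minus_cancel)
    finally show "\<psi> g = g (y \<oplus>\<^bsub>M\<^esub> c \<odot>\<^bsub>M\<^esub> a)" ..
  qed
qed

text \<open>The evaluations at generators of \<open>M\<close> have no common zero but \<open>0\<close>, so that the vanishing condition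
  of the preceding lemma holds for every functional.\<close>

lemma functional_on_dual_is_evaluation:
  assumes QF: "quasi_Frobenius_ring R" and fg: "finitely_generated_module R M"
    and L: "submodule L R M_dual" and f: "functional_on (opposite_ring R) M_dual L \<psi>"
  shows "\<exists>x\<in>carrier M. \<forall>g\<in>L. \<psi> g = g x"
proof -
  obtain A where A: "finite A" "A \<subseteq> carrier M"
    "\<And>N. \<lbrakk>submodule N R M; A \<subseteq> N\<rbrakk> \<Longrightarrow> carrier M \<subseteq> N"
    using finitely_generated_moduleE[OF fg] by blast
  show ?thesis
  proof (rule functional_vanishing_on_common_zeros_is_evaluation[OF QF A(1,2) L f])
    fix g assume g: "g \<in> L" and gA: "\<And>a. a \<in> A \<Longrightarrow> g a = \<zero>"
    have gd: "g \<in> carrier M_dual" using dual_submoduleD(1)[OF L g] .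
    have "submodule {x \<in> carrier M. g x = \<zero>} R M"
      unfolding submodule_iff using dualD[OF gd] dual_zero[OF gd] by auto
    then have "carrier M \<subseteq> {x \<in> carrier M. g x = \<zero>}"
      using A gA by (intro A(3)) auto
    then have "g = \<zero>\<^bsub>M_dual\<^esub>"
      using dualD(4)[OF gd] by (auto simp: dual_module_simps extensional_def fun_eq_iff)
    then show "\<psi> g = \<zero>"
      using left_module.functional_zero[OF dual_left_module, of L \<psi>] L f
      by (simp add: submodule_opposite)
  qed
qed

text \<open>Separate \<open>h\<close> from \<open>L\<close> by a functional on a submodule of \<open>M\<^sup>*\<close> that contains both. The point at
  which this functional is the evaluation is the one sought.\<close>

lemma dual_submodule_vanishing_point:
  assumes QF: "quasi_Frobenius_ring R" and fg: "finitely_generated_module R M"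
    and L: "submodule L R M_dual" and h: "h \<in> carrier M_dual" "h \<notin> L"
  obtains x where "x \<in> carrier M" "\<And>g. g \<in> L \<Longrightarrow> g x = \<zero>" "h x \<noteq> \<zero>"
proof -
  have Lop: "submodule L (opposite_ring R) M_dual"
    using L by (simp add: submodule_opposite)
  obtain L' \<psi> where L': "submodule L' (opposite_ring R) M_dual" "L \<subseteq> L'" "h \<in> L'"
      "functional_on (opposite_ring R) M_dual L' \<psi>"
      "\<And>g. g \<in> L \<Longrightarrow> \<psi> g = \<zero>\<^bsub>opposite_ring R\<^esub>" "\<psi> h \<noteq> \<zero>\<^bsub>opposite_ring R\<^esub>"
    using left_module.functional_separate[OF dual_left_module quasi_Frobenius_opposite[OF QF] Lop h]
    by blast
  obtain x where "x \<in> carrier M" "\<forall>g\<in>L'. \<psi> g = g x"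
    using functional_on_dual_is_evaluation[OF QF fg _ L'(4)] L'(1) by (auto simp: submodule_opposite)
  then show thesis
    using L' by (intro that[of x]) (auto simp: subset_iff)
qed

end

section \<open>Transposes of endomorphisms\<close>

lemma module_homs_iff:
  "f \<in> module_homs R X Y \<longleftrightarrow> f \<in> extensional (carrier X) \<and> (\<forall>x\<in>carrier X. f x \<in> carrier Y) \<and>
    (\<forall>x\<in>carrier X. \<forall>y\<in>carrier X. f (x \<oplus>\<^bsub>X\<^esub> y) = f x \<oplus>\<^bsub>Y\<^esub> f y) \<and>
    (\<forall>a\<in>carrier R. \<forall>x\<in>carrier X. f (a \<odot>\<^bsub>X\<^esub> x) = a \<odot>\<^bsub>Y\<^esub> f x)"
  by (auto simp: module_homs_def hom_def)

lemma module_homsD: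
  assumes "f \<in> module_homs R X Y"
  shows "x \<in> carrier X \<Longrightarrow> f x \<in> carrier Y"
    and "\<lbrakk>x \<in> carrier X; y \<in> carrier X\<rbrakk> \<Longrightarrow> f (x \<oplus>\<^bsub>X\<^esub> y) = f x \<oplus>\<^bsub>Y\<^esub> f y"
    and "\<lbrakk>a \<in> carrier R; x \<in> carrier X\<rbrakk> \<Longrightarrow> f (a \<odot>\<^bsub>X\<^esub> x) = a \<odot>\<^bsub>Y\<^esub> f x"
    and "f \<in> extensional (carrier X)"
  using assms by (simp_all add: module_homs_iff)

context left_module
begin

definition transpose_map :: "('c \<Rightarrow> 'c) \<Rightarrow> ('c \<Rightarrow> 'a) \<Rightarrow> 'c \<Rightarrow> 'a" where
  "transpose_map f = (\<lambda>g\<in>carrier M_dual. \<lambda>x\<in>carrier M. g (f x))"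

lemma transpose_apply:
  "\<lbrakk>g \<in> carrier M_dual; x \<in> carrier M\<rbrakk> \<Longrightarrow> transpose_map f g x = g (f x)"
  by (simp add: transpose_map_def)

lemma dual_module_eqI:
  assumes "g \<in> carrier M_dual" "h \<in> carrier M_dual" "\<And>x. x \<in> carrier M \<Longrightarrow> g x = h x"
  shows "g = h"
  using dualD(4)[OF assms(1)] dualD(4)[OF assms(2)] assms(3) by (rule extensionalityI)

lemma dual_closed:
  shows "\<lbrakk>g \<in> carrier M_dual; h \<in> carrier M_dual\<rbrakk> \<Longrightarrow> g \<oplus>\<^bsub>M_dual\<^esub> h \<in> carrier M_dual"
    and "\<lbrakk>a \<in> carrier R; g \<in> carrier M_dual\<rbrakk> \<Longrightarrow> a \<odot>\<^bsub>M_dual\<^esub> g \<in> carrier M_dual"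
    and "\<zero>\<^bsub>M_dual\<^esub> \<in> carrier M_dual"
  using right_module.smult_closed[OF right_module_dual]
    abelian_group.axioms(1)[OF right_module.axioms(2)[OF right_module_dual]]
  by (auto intro: abelian_monoid.a_closed abelian_monoid.zero_closed)

lemma dual_apply:
  assumes "x \<in> carrier M"
  shows "(g \<oplus>\<^bsub>M_dual\<^esub> h) x = g x \<oplus> h x" "(a \<odot>\<^bsub>M_dual\<^esub> g) x = g x \<otimes> a" "\<zero>\<^bsub>M_dual\<^esub> x = \<zero>"
  using assms by (simp_all add: dual_module_simps)

lemma transpose_closed:
  assumes f: "f \<in> module_endos R M" and g: "g \<in> carrier M_dual"
  shows "transpose_map f g \<in> carrier M_dual"
  using g dualD[OF g] module_homsD[OF f] by (auto simp: mem_dual_iff transpose_map_def)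

lemma transpose_endo:
  assumes f: "f \<in> module_endos R M"
  shows "transpose_map f \<in> module_endos R M_dual"
  unfolding module_homs_iff[of "transpose_map f"]
proof (intro conjI ballI)
  show "transpose_map f \<in> extensional (carrier M_dual)"
    by (simp add: transpose_map_def)
next
  fix g assume g: "g \<in> carrier M_dual"
  then show "transpose_map f g \<in> carrier M_dual" by (rule transpose_closed[OF f])
next
  fix g h assume gh: "g \<in> carrier M_dual" "h \<in> carrier M_dual"
  show "transpose_map f (g \<oplus>\<^bsub>M_dual\<^esub> h) = transpose_map f g \<oplus>\<^bsub>M_dual\<^esub> transpose_map f h"
    by (rule dual_module_eqI)
      (simp_all add: gh dual_closed transpose_closed f transpose_apply dual_apply module_homsD(1)[OF f])
next
  fix a g assume ag: "a \<in> carrier R" "g \<in> carrier M_dual"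
  show "transpose_map f (a \<odot>\<^bsub>M_dual\<^esub> g) = a \<odot>\<^bsub>M_dual\<^esub> transpose_map f g"
    by (rule dual_module_eqI)
      (simp_all add: ag dual_closed transpose_closed f transpose_apply dual_apply module_homsD(1)[OF f])
qed

lemma transpose_zero: "transpose_map (\<lambda>x\<in>carrier M. \<zero>\<^bsub>M\<^esub>) = (\<lambda>g\<in>carrier M_dual. \<zero>\<^bsub>M_dual\<^esub>)"
  by (auto simp: transpose_map_def dual_zero dual_module_simps(4) fun_eq_iff)

definition dual_annihilator :: "'c set \<Rightarrow> ('c \<Rightarrow> 'a) set" where
  "dual_annihilator K = {g \<in> carrier M_dual. \<forall>x\<in>K. g x = \<zero>}"

definition common_kernel :: "('c \<Rightarrow> 'a) set \<Rightarrow> 'c set" where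
  "common_kernel L = {x \<in> carrier M. \<forall>g\<in>L. g x = \<zero>}"

lemma submodule_dual_annihilator:
  assumes "K \<subseteq> carrier M" shows "submodule (dual_annihilator K) R M_dual"
proof -
  have "submodule (dual_annihilator K) (opposite_ring R) M_dual"
    unfolding left_module.submodule_iff[OF dual_left_module] dual_annihilator_def
    using assms by (auto simp: dual_closed dual_apply subset_iff)
  then show ?thesis by (simp add: submodule_opposite)
qed

text \<open>For \<open>g \<in> L\<close> also \<open>g \<circ> f\<close>, the image of \<open>g\<close> under the transpose of \<open>f\<close>, belongs to \<open>L\<close>; so \<open>g\<close> kills
  \<open>f x\<close> whenever \<open>L\<close> kills \<open>x\<close>.\<close>

lemma fully_invariant_common_kernel:
  assumes L: "fully_invariant R M_dual L"
  shows "fully_invariant R M (common_kernel L)"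
proof -
  have sub: "submodule L R M_dual" using L by (simp add: fully_invariant_def)
  note LD = dualD[OF dual_submoduleD(1)[OF sub]] dual_zero[OF dual_submoduleD(1)[OF sub]]
  have "submodule (common_kernel L) R M"
    unfolding submodule_iff common_kernel_def by (auto simp: LD)
  moreover have "f x \<in> common_kernel L" if f: "f \<in> module_endos R M" and x: "x \<in> common_kernel L" for f x
  proof -
    have xM: "x \<in> carrier M" using x by (simp add: common_kernel_def)
    have "g (f x) = \<zero>" if g: "g \<in> L" for g
    proof -
      have "transpose_map f g \<in> L"
        using L transpose_endo[OF f] g by (auto simp: fully_invariant_def)
      then show ?thesis
        using x transpose_apply[OF dual_submoduleD(1)[OF sub g] xM, of f]
        by (simp add: common_kernel_def)
    qed
    then show ?thesis using module_homsD(1)[OF f xM] by (simp add: common_kernel_def)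
  qed
  ultimately show ?thesis by (auto simp: fully_invariant_def)
qed

end

section \<open>Duality for finitely generated modules over a quasi-Frobenius ring\<close>

locale finitely_generated_over_QF = left_module +
  assumes QF: "quasi_Frobenius_ring R" and fg: "finitely_generated_module R M"
begin

text \<open>For each \<open>x\<close> the map \<open>g \<mapsto> h g x\<close> is a functional on \<open>M\<^sup>*\<close>, that is, evaluation at a point \<open>f x\<close>.
  The linearity of \<open>f\<close> can be tested by applying all \<open>g\<close>, as functionals separate points.\<close>

lemma transpose_surj:
  assumes h: "h \<in> module_endos R M_dual"
  obtains f where "f \<in> module_endos R M" "transpose_map f = h"
proof -
  note hD = module_homsD[OF h]
  have "\<exists>y\<in>carrier M. \<forall>g\<in>carrier M_dual. h g x = g y" if x: "x \<in> carrier M" for x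
  proof (rule functional_on_dual_is_evaluation[OF QF fg])
    show "submodule (carrier M_dual) R M_dual"
      using left_module.submodule_carrier[OF dual_left_module] by (simp add: submodule_opposite)
    show "functional_on (opposite_ring R) M_dual (carrier M_dual) (\<lambda>g. h g x)"
      using x by (simp add: functional_on_def hD dual_apply dualD(1))
  qed
  then obtain f where f: "\<And>x. x \<in> carrier M \<Longrightarrow> f x \<in> carrier M"
    and fh: "\<And>x g. \<lbrakk>x \<in> carrier M; g \<in> carrier M_dual\<rbrakk> \<Longrightarrow> g (f x) = h g x"
    by metis
  have add: "f (x \<oplus>\<^bsub>M\<^esub> y) = f x \<oplus>\<^bsub>M\<^esub> f y" if "x \<in> carrier M" "y \<in> carrier M" for x y
    by (rule dual_separates_points[OF QF fg]) (simp_all add: that f dualD(2) fh hD(1))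
  have smult: "f (a \<odot>\<^bsub>M\<^esub> x) = a \<odot>\<^bsub>M\<^esub> f x" if "a \<in> carrier R" "x \<in> carrier M" for a x
    by (rule dual_separates_points[OF QF fg]) (simp_all add: that f dualD(3) fh hD(1))
  let ?f = "restrict f (carrier M)"
  have endo: "?f \<in> module_endos R M"
    unfolding module_homs_iff[of ?f] by (simp add: f add smult)
  have "transpose_map ?f = h"
  proof (rule extensionalityI[OF _ hD(4)])
    show "transpose_map ?f \<in> extensional (carrier M_dual)" by (simp add: transpose_map_def)
    show "transpose_map ?f g = h g" if "g \<in> carrier M_dual" for g
      by (rule dual_module_eqI) (simp_all add: that hD(1) transpose_closed endo transpose_apply fh)
  qed
  with endo show thesis by (rule that)
qed

lemma transpose_eq_zero_iff:
  assumes f: "f \<in> module_endos R M"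
  shows "transpose_map f = (\<lambda>g\<in>carrier M_dual. \<zero>\<^bsub>M_dual\<^esub>) \<longleftrightarrow> f = (\<lambda>x\<in>carrier M. \<zero>\<^bsub>M\<^esub>)"
proof
  assume z: "transpose_map f = (\<lambda>g\<in>carrier M_dual. \<zero>\<^bsub>M_dual\<^esub>)"
  have "f x = \<zero>\<^bsub>M\<^esub>" if x: "x \<in> carrier M" for x
  proof (rule dual_separates_points[OF QF fg])
    fix g assume g: "g \<in> carrier M_dual"
    then show "g (f x) = g \<zero>\<^bsub>M\<^esub>"
      using transpose_apply[OF g x, of f] x by (simp add: z dual_apply dual_zero)
  qed (simp_all add: module_homsD(1)[OF f x])
  then show "f = (\<lambda>x\<in>carrier M. \<zero>\<^bsub>M\<^esub>)"
    using module_homsD(4)[OF f] by (intro extensionalityI[of _ "carrier M"]) simp_all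
qed (simp add: transpose_zero)

text \<open>Here all endomorphisms of \<open>M\<^sup>*\<close> have to be considered; that they are transposes of
  endomorphisms of \<open>M\<close> is what makes the claim true.\<close>

lemma fully_invariant_dual_annihilator:
  assumes K: "fully_invariant R M K"
  shows "fully_invariant R M_dual (dual_annihilator K)"
proof -
  have KM: "K \<subseteq> carrier M" using K by (auto simp: fully_invariant_def submodule_iff)
  have "h g \<in> dual_annihilator K"
    if h: "h \<in> module_endos R M_dual" and g: "g \<in> dual_annihilator K" for h g
  proof -
    obtain f where f: "f \<in> module_endos R M" "transpose_map f = h" using transpose_surj[OF h] .
    have "f ` K \<subseteq> K" using K f(1) by (simp add: fully_invariant_def)
    then show ?thesis
      using g KM by (auto simp: dual_annihilator_def f(2)[symmetric] transpose_closed f(1)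
          transpose_apply subset_iff)
  qed
  then show ?thesis
    using submodule_dual_annihilator[OF KM] by (auto simp: fully_invariant_def)
qed

lemma nonzero_module_dual:
  assumes "nonzero_module M" shows "nonzero_module M_dual"
proof -
  obtain x where x: "x \<in> carrier M" "x \<noteq> \<zero>\<^bsub>M\<^esub>"
    using assms unfolding nonzero_module_def by blast
  then obtain g where "g \<in> carrier M_dual" "g x \<noteq> g \<zero>\<^bsub>M\<^esub>"
    using dual_separates_points[OF QF fg x(1), of "\<zero>\<^bsub>M\<^esub>"] by auto
  then have "g \<noteq> \<zero>\<^bsub>M_dual\<^esub>" using x by (auto simp: dual_apply)
  then show ?thesis using \<open>g \<in> carrier M_dual\<close> by (auto simp: nonzero_module_def)
qed

lemma vanishes_on_iff_transpose:
  assumes f: "f \<in> module_endos R M" and K: "K \<subseteq> carrier M"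
  shows "(\<forall>x\<in>K. f x = \<zero>\<^bsub>M\<^esub>) \<longleftrightarrow> transpose_map f ` carrier M_dual \<subseteq> dual_annihilator K"
proof
  assume "\<forall>x\<in>K. f x = \<zero>\<^bsub>M\<^esub>"
  then show "transpose_map f ` carrier M_dual \<subseteq> dual_annihilator K"
    using K by (auto simp: dual_annihilator_def transpose_closed f transpose_apply dual_zero subset_iff)
next
  assume im: "transpose_map f ` carrier M_dual \<subseteq> dual_annihilator K"
  show "\<forall>x\<in>K. f x = \<zero>\<^bsub>M\<^esub>"
  proof
    fix x assume "x \<in> K"
    then have x: "x \<in> carrier M" using K by blast
    show "f x = \<zero>\<^bsub>M\<^esub>"
    proof (rule dual_separates_points[OF QF fg])
      fix g assume g: "g \<in> carrier M_dual"
      then have "transpose_map f g x = \<zero>" using im \<open>x \<in> K\<close> by (auto simp: dual_annihilator_def)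
      then show "g (f x) = g \<zero>\<^bsub>M\<^esub>" by (simp add: transpose_apply g x dual_zero)
    qed (simp_all add: module_homsD(1)[OF f x])
  qed
qed

lemma dual_annihilator_common_kernel:
  assumes L: "submodule L R M_dual"
  shows "dual_annihilator (common_kernel L) = L"
proof
  show "L \<subseteq> dual_annihilator (common_kernel L)"
    using dual_submoduleD(1)[OF L] by (auto simp: dual_annihilator_def common_kernel_def)
  show "dual_annihilator (common_kernel L) \<subseteq> L"
  proof
    fix h assume h: "h \<in> dual_annihilator (common_kernel L)"
    show "h \<in> L"
    proof (rule ccontr)
      assume "h \<notin> L"
      moreover have "h \<in> carrier M_dual" using h by (simp add: dual_annihilator_def)
      ultimately obtain x where "x \<in> carrier M" "\<And>g. g \<in> L \<Longrightarrow> g x = \<zero>" "h x \<noteq> \<zero>"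
        using dual_submodule_vanishing_point[OF QF fg L] by blast
      then show False using h by (auto simp: dual_annihilator_def common_kernel_def)
    qed
  qed
qed

lemma common_kernel_dual_annihilator:
  assumes K: "submodule K R M"
  shows "common_kernel (dual_annihilator K) = K"
proof
  show "K \<subseteq> common_kernel (dual_annihilator K)"
    using submoduleD(1)[OF K] by (auto simp: dual_annihilator_def common_kernel_def)
  show "common_kernel (dual_annihilator K) \<subseteq> K"
  proof
    fix x assume x: "x \<in> common_kernel (dual_annihilator K)"
    show "x \<in> K"
    proof (rule ccontr)
      assume "x \<notin> K"
      moreover have "x \<in> carrier M" using x by (simp add: common_kernel_def)
      ultimately obtain g where "g \<in> carrier M_dual" "\<And>n. n \<in> K \<Longrightarrow> g n = \<zero>" "g x \<noteq> \<zero>"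
        using dual_separates[OF QF fg K] by blast
      then show False using x by (auto simp: dual_annihilator_def common_kernel_def)
    qed
  qed
qed

lemma image_subset_iff_transpose:
  assumes f: "f \<in> module_endos R M" and K: "submodule K R M"
  shows "f ` carrier M \<subseteq> K \<longleftrightarrow> (\<forall>g\<in>dual_annihilator K. transpose_map f g = \<zero>\<^bsub>M_dual\<^esub>)"
proof
  assume im: "f ` carrier M \<subseteq> K"
  show "\<forall>g\<in>dual_annihilator K. transpose_map f g = \<zero>\<^bsub>M_dual\<^esub>"
  proof
    fix g assume g: "g \<in> dual_annihilator K"
    then have gd: "g \<in> carrier M_dual" by (simp add: dual_annihilator_def)
    show "transpose_map f g = \<zero>\<^bsub>M_dual\<^esub>"
    proof (rule dual_module_eqI)
      fix x assume x: "x \<in> carrier M"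
      then have "f x \<in> K" using im by blast
      then show "transpose_map f g x = \<zero>\<^bsub>M_dual\<^esub> x"
        using g x by (simp add: transpose_apply gd dual_apply dual_annihilator_def)
    qed (simp_all add: transpose_closed f gd dual_closed)
  qed
next
  assume z: "\<forall>g\<in>dual_annihilator K. transpose_map f g = \<zero>\<^bsub>M_dual\<^esub>"
  have "f x \<in> common_kernel (dual_annihilator K)" if x: "x \<in> carrier M" for x
  proof -
    have "g (f x) = \<zero>" if g: "g \<in> dual_annihilator K" for g
    proof -
      have "g \<in> carrier M_dual" using g by (simp add: dual_annihilator_def)
      then show ?thesis using z g x by (metis transpose_apply dual_apply(3))
    qed
    then show ?thesis by (simp add: common_kernel_def module_homsD(1)[OF f x])
  qed
  then show "f ` carrier M \<subseteq> K"
    unfolding common_kernel_dual_annihilator[OF K] by blast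
qed

lemma dual_annihilator_eq_carrier_iff:
  assumes K: "submodule K R M"
  shows "dual_annihilator K = carrier M_dual \<longleftrightarrow> K = {\<zero>\<^bsub>M\<^esub>}"
proof
  assume "dual_annihilator K = carrier M_dual"
  moreover have "dual_annihilator {\<zero>\<^bsub>M\<^esub>} = carrier M_dual"
    by (auto simp: dual_annihilator_def dual_zero)
  moreover have "submodule {\<zero>\<^bsub>M\<^esub>} R M" by (simp add: submodule_iff)
  ultimately show "K = {\<zero>\<^bsub>M\<^esub>}"
    using common_kernel_dual_annihilator K by metis
qed (auto simp: dual_annihilator_def dual_zero)

lemma dual_annihilator_eq_zero_iff:
  assumes K: "submodule K R M"
  shows "dual_annihilator K = {\<zero>\<^bsub>M_dual\<^esub>} \<longleftrightarrow> K = carrier M"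
proof -
  have M: "dual_annihilator (carrier M) = {\<zero>\<^bsub>M_dual\<^esub>}"
  proof
    show "dual_annihilator (carrier M) \<subseteq> {\<zero>\<^bsub>M_dual\<^esub>}"
    proof
      fix g assume "g \<in> dual_annihilator (carrier M)"
      then have "g = \<zero>\<^bsub>M_dual\<^esub>"
        by (intro dual_module_eqI) (simp_all add: dual_annihilator_def dual_closed dual_apply)
      then show "g \<in> {\<zero>\<^bsub>M_dual\<^esub>}" by simp
    qed
  qed (simp add: dual_annihilator_def dual_closed dual_apply)
  then show ?thesis
    using common_kernel_dual_annihilator[OF K] common_kernel_dual_annihilator[OF submodule_carrier]
    by metis
qed

text \<open>Quantification over the fully invariant submodules or the endomorphisms of \<open>M\<^sup>*\<close> can be
  replaced by quantification over those of \<open>M\<close>, because \<open>dual_annihilator\<close> and \<open>transpose_map\<close> are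
  onto. This reduces the two equivalences below to a comparison for a single \<open>K\<close> and a single \<open>f\<close>.\<close>

lemma all_fully_invariant_dual_iff:
  "(\<forall>L. fully_invariant R M_dual L \<longrightarrow> P L) \<longleftrightarrow>
    (\<forall>K. fully_invariant R M K \<longrightarrow> P (dual_annihilator K))"
proof (intro iffI allI impI)
  fix L assume "\<forall>K. fully_invariant R M K \<longrightarrow> P (dual_annihilator K)"
    and L: "fully_invariant R M_dual L"
  then have "P (dual_annihilator (common_kernel L))"
    using fully_invariant_common_kernel by blast
  then show "P L"
    using L by (simp add: dual_annihilator_common_kernel fully_invariant_def)
qed (use fully_invariant_dual_annihilator in blast)

lemma all_endos_dual_iff:
  "(\<forall>h\<in>module_endos R M_dual. P h) \<longleftrightarrow> (\<forall>f\<in>module_endos R M. P (transpose_map f))"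
  using transpose_endo transpose_surj by metis

lemma endo_coprime_dual_iff:
  assumes "nonzero_module M"
  shows "endo_coprime R M_dual \<longleftrightarrow> endo_prime R M"
proof -
  let ?P = "\<lambda>K. K \<noteq> carrier M_dual \<longrightarrow>
      (\<forall>f\<in>module_endos R M_dual. f ` carrier M_dual \<subseteq> K \<longrightarrow> f = (\<lambda>g\<in>carrier M_dual. \<zero>\<^bsub>M_dual\<^esub>))"
  let ?Q = "\<lambda>K. K \<noteq> {\<zero>\<^bsub>M\<^esub>} \<longrightarrow>
      (\<forall>f\<in>module_endos R M. (\<forall>x\<in>K. f x = \<zero>\<^bsub>M\<^esub>) \<longrightarrow> f = (\<lambda>x\<in>carrier M. \<zero>\<^bsub>M\<^esub>))"
  have eq: "?P (dual_annihilator K) \<longleftrightarrow> ?Q K" if "fully_invariant R M K" for K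
  proof -
    have K: "submodule K R M" "K \<subseteq> carrier M"
      using that by (auto simp: fully_invariant_def submodule_iff)
    show ?thesis
      unfolding dual_annihilator_eq_carrier_iff[OF K(1)] all_endos_dual_iff
      by (simp add: vanishes_on_iff_transpose[OF _ K(2)] transpose_eq_zero_iff)
  qed
  have "endo_coprime R M_dual \<longleftrightarrow> (\<forall>L. fully_invariant R M_dual L \<longrightarrow> ?P L)"
    unfolding endo_coprime_def using nonzero_module_dual[OF assms] by blast
  also have "\<dots> \<longleftrightarrow> (\<forall>K. fully_invariant R M K \<longrightarrow> ?P (dual_annihilator K))"
    by (rule all_fully_invariant_dual_iff)
  also have "\<dots> \<longleftrightarrow> (\<forall>K. fully_invariant R M K \<longrightarrow> ?Q K)"
    by (rule all_cong1, rule imp_cong[OF refl], rule eq)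
  also have "\<dots> \<longleftrightarrow> endo_prime R M"
    unfolding endo_prime_def using assms by blast
  finally show ?thesis .
qed

lemma endo_prime_dual_iff:
  assumes "nonzero_module M"
  shows "endo_prime R M_dual \<longleftrightarrow> endo_coprime R M"
proof -
  let ?P = "\<lambda>K. K \<noteq> {\<zero>\<^bsub>M_dual\<^esub>} \<longrightarrow>
      (\<forall>f\<in>module_endos R M_dual. (\<forall>x\<in>K. f x = \<zero>\<^bsub>M_dual\<^esub>) \<longrightarrow> f = (\<lambda>g\<in>carrier M_dual. \<zero>\<^bsub>M_dual\<^esub>))"
  let ?Q = "\<lambda>K. K \<noteq> carrier M \<longrightarrow>
      (\<forall>f\<in>module_endos R M. f ` carrier M \<subseteq> K \<longrightarrow> f = (\<lambda>x\<in>carrier M. \<zero>\<^bsub>M\<^esub>))"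
  have eq: "?P (dual_annihilator K) \<longleftrightarrow> ?Q K" if "fully_invariant R M K" for K
  proof -
    have K: "submodule K R M"
      using that by (simp add: fully_invariant_def)
    show ?thesis
      unfolding dual_annihilator_eq_zero_iff[OF K] all_endos_dual_iff
      by (simp add: image_subset_iff_transpose[OF _ K] transpose_eq_zero_iff)
  qed
  have "endo_prime R M_dual \<longleftrightarrow> (\<forall>L. fully_invariant R M_dual L \<longrightarrow> ?P L)"
    unfolding endo_prime_def using nonzero_module_dual[OF assms] by blast
  also have "\<dots> \<longleftrightarrow> (\<forall>K. fully_invariant R M K \<longrightarrow> ?P (dual_annihilator K))"
    by (rule all_fully_invariant_dual_iff)
  also have "\<dots> \<longleftrightarrow> (\<forall>K. fully_invariant R M K \<longrightarrow> ?Q K)"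
    by (rule all_cong1, rule imp_cong[OF refl], rule eq)
  also have "\<dots> \<longleftrightarrow> endo_coprime R M"
    unfolding endo_coprime_def using assms by blast
  finally show ?thesis .
qed

end

theorem theorem3p1:
  fixes R :: "('a, 'r) ring_scheme" and M :: "('a, 'b, 'm) module_scheme"
  assumes "quasi_Frobenius_ring R"
    and "left_module R M"
    and "nonzero_module M"
    and "finitely_generated_module R M"
  shows "(endo_prime R M \<longleftrightarrow> endo_coprime R (dual_module R M)) \<and>
    (endo_coprime R M \<longleftrightarrow> endo_prime R (dual_module R M))"
proof -
  interpret finitely_generated_over_QF R M
    using assms by (simp add: finitely_generated_over_QF_def finitely_generated_over_QF_axioms_def)
  show ?thesis
    using endo_coprime_dual_iff[OF assms(3)] endo_prime_dual_iff[OF assms(3)] by blast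
qed

end
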